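(* Let $p$ be a prime, let $f(t)$ be an irreducible polynomial of degree $d\ge 1$ in $\Lambda_p=\mathbb{Z}_p[t^{\pm1}]$ with $f(t)\neq t,\,t-1$, and let $F_q=\Lambda_p/f(t)$, $q=p^d$. Let $D$ be a diagram of a welded knot $K$ and let $\operatorname{Col}_{F_q}(D)$ be the set of colorings of $D$ by the quandle $F_q$, viewed as a vector space over the field $F_q$. Then $$\dim \operatorname{Col}_{F_q}(D)-1\ \leq\ ut(K),$$ where $ut(K)$ is the unknotting twist number of $K$.
   Context: A welded knot diagram is a generic immersion of one circle in the plane in which every double point is marked either as a classical crossing (with over/under information) or as a welded crossing (no over/under information). Welded Reidemeister moves are: the classical Reidemeister moves RI, RII, RIII; the moves VRI, VRII, VRIII (the versions of RI, RII, RIII in which all crossings are welded); the move SV (the Reidemeister-III-type move in which an arc having two welded crossings is moved across a classical crossing); and the move $F_1$ (the Reidemeister-III-type move in which an arc passing over two strands at two classical crossings is moved across the welded crossing of these two strands). Two diagrams are equivalent if related by a finite sequence of welded Reidemeister moves (and planar isotopy); a welded knot $K$ is an equivalence class, and $D\in[K]$ means that $D$ is a diagram of $K$. The trivial welded knot is the class of the diagram without crossings. Equivalently, a diagram up to VRI, VRII, VRIII, SV is determined by its signed Gauss diagram (one arrow per classical crossing, from over- to under-passage, labelled by the sign of the crossing); $F_1$ exchanges two adjacent arrow tails. Twist move at a classical crossing $c$: replace a small neighbourhood of $c$, viewed as a 2-strand tangle consisting of the single crossing $c$, by the 2-strand tangle obtained by placing a welded crossing of the two strands on each of two opposite sides of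 the classical crossing (a vertical stack welded–classical–welded), the classical crossing being drawn with the same picture; the inverse replacement is also a twist move. It exchanges the over- and under-passing strands at $c$ while preserving the sign of $c$ (on the Gauss diagram: reverses the arrow of $c$, keeps its sign). Unknotting twist number: $ut(D)$ is the minimum number of twist moves (applied at classical crossings of $D$) required to change $D$ into a diagram of the trivial welded knot, and $ut(K)=\min\{ut(D)\mid D\in[K]\}$. Colorings: $F_q$ is a finite field, made into a quandle (Alexander quandle) by $x*y=tx+(1-t)y$. Orient $D$. An arc of $D$ is a piece of the curve whose endpoints are undercrossings (arcs pass through overcrossings and welded crossings; if there are no undercrossings, the whole curve is the only arc). The normal of an arc is chosen so that (tangent, normal) agrees with the orientation of the plane. A coloring of $D$ by $F_q$ is a map $\mathcal{C}$ from the set of arcs to $F_q$ such that at every classical crossing with over-arc $\beta$ whose normal points from the under-arc $\alpha$ to the under-arc $\gamma$ one has $\mathcal{C}(\gamma)=\mathcal{C}(\alpha)*\mathcal{C}(\beta)=t\,\mathcal{C}(\alpha)+(1-t)\,\mathcal{C}(\beta)$. The set $\operatorname{Col}_{F_q}(D)$ of colorings is a vector space over $F_q$, whose dimension is a welded knot invariant. *)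

theory Defs
  imports
    "HOL-Algebra.Algebra"
    "HOL-Number_Theory.Residues"
    "Jordan_Normal_Form.Missing_VectorSpace"
begin

section \<open>Welded knot diagrams\<close>

text \<open>A diagram, taken modulo the moves VRI, VRII, VRIII and SV, is represented by its signed Gauss
  diagram. We write a Gauss diagram as the cyclic word of the passages through classical crossings
  met when traversing the curve from a base point in a chosen direction: \<open>Over c e\<close> is the tail and
  \<open>Under c e\<close> the head of the arrow of the crossing named \<open>c\<close>, which has sign \<open>e\<close>. The choice of
  base point, direction and crossing names is divided out in \<open>welded_move\<close> below.\<close>

datatype passage = Over nat int | Under nat int

fun crossing :: "passage \<Rightarrow> nat" where
  "crossing (Over c e) = c"
| "crossing (Under c e) = c"

fun is_over :: "passage \<Rightarrow> bool" where
  "is_over (Over c e) = True"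
| "is_over (Under c e) = False"

definition gauss_diagram :: "passage list \<Rightarrow> bool" where
  "gauss_diagram w \<longleftrightarrow>
     distinct w \<and>
     (\<forall>c e. Over c e \<in> set w \<longleftrightarrow> Under c e \<in> set w) \<and>
     (\<forall>c e. Over c e \<in> set w \<longrightarrow> e \<in> {1, -1}) \<and>
     (\<forall>c e e'. Over c e \<in> set w \<longrightarrow> Over c e' \<in> set w \<longrightarrow> e = e')"

fun relabel :: "(nat \<Rightarrow> nat) \<Rightarrow> passage \<Rightarrow> passage" where
  "relabel \<pi> (Over c e) = Over (\<pi> c) e"
| "relabel \<pi> (Under c e) = Under (\<pi> c) e"

definition directed :: "int \<Rightarrow> 'a list \<Rightarrow> 'a list" where
  "directed s xs = (if s = 1 then xs else rev xs)"

text \<open>The three strands of an RIII move: \<open>T\<close> passes over \<open>M\<close> (at \<open>a\<close>) and over \<open>B\<close> (at \<open>b\<close>), and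
  \<open>M\<close> passes over \<open>B\<close> (at \<open>c\<close>). Model them by straight lines with directions \<open>T, M, B\<close> in the plane;
  the sign of a crossing of \<open>X\<close> over \<open>Y\<close> is the sign of \<open>det(X, Y)\<close>. Place the crossing \<open>c\<close> at the
  origin and let \<open>T\<close> be the line \<open>det(T, x) = k\<close>, where \<open>k\<close> changes sign under the move. Then
  \<open>a = (k / det(T, M)) M\<close>, \<open>b = (k / det(T, B)) B\<close> and
  \<open>b - a = - (k det(M, B) / (det(T, M) det(T, B))) T\<close>, which gives the order of the two passages
  on each strand in terms of the signs \<open>ea, eb, ec\<close> of the crossings and the sign \<open>s\<close> of \<open>-k\<close>.
  All eight triples of signs occur.\<close>

definition R3_strands ::
  "int \<Rightarrow> nat \<Rightarrow> nat \<Rightarrow> nat \<Rightarrow> int \<Rightarrow> int \<Rightarrow> int \<Rightarrow> passage list set" where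
  "R3_strands s a b c ea eb ec =
     {directed (s * ea * eb * ec) [Over a ea, Over b eb],
      directed (s * ea) [Under a ea, Over c ec],
      directed (s * eb) [Under b eb, Under c ec]}"

text \<open>The first three rules only change the base point, the crossing names and the direction in
  which the curve is traversed (diagrams are unoriented; reversing the direction preserves the
  crossing signs). The words \<open>u, v, \<dots>\<close> may be empty. Since all letters of a Gauss word are
  distinct, the set equation in \<open>R3\<close> says that \<open>p, q, r\<close> are the three strands in some order.\<close>

inductive welded_move :: "passage list \<Rightarrow> passage list \<Rightarrow> bool" where
  base_point: "gauss_diagram w \<Longrightarrow> gauss_diagram (rotate1 w) \<Longrightarrow> welded_move w (rotate1 w)"
| names: "gauss_diagram w \<Longrightarrow> gauss_diagram (map (relabel \<pi>) w) \<Longrightarrow> inj \<pi> \<Longrightarrow>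
    welded_move w (map (relabel \<pi>) w)"
| reverse: "gauss_diagram w \<Longrightarrow> gauss_diagram (rev w) \<Longrightarrow> welded_move w (rev w)"
| R1: "gauss_diagram (u @ v) \<Longrightarrow> gauss_diagram (u @ p @ v) \<Longrightarrow>
    p = [Over c e, Under c e] \<or> p = [Under c e, Over c e] \<Longrightarrow>
    welded_move (u @ v) (u @ p @ v)"
| R2: "gauss_diagram (u @ v @ x) \<Longrightarrow> gauss_diagram (u @ p @ v @ q @ x) \<Longrightarrow>
    po = [Over c e, Over d (- e)] \<Longrightarrow>
    pu = [Under c e, Under d (- e)] \<or> pu = [Under d (- e), Under c e] \<Longrightarrow>
    p = po \<and> q = pu \<or> p = pu \<and> q = po \<Longrightarrow>
    welded_move (u @ v @ x) (u @ p @ v @ q @ x)"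
| R3: "gauss_diagram (u @ p @ v @ q @ x @ r @ y) \<Longrightarrow>
    gauss_diagram (u @ rev p @ v @ rev q @ x @ rev r @ y) \<Longrightarrow>
    s \<in> {1, -1} \<Longrightarrow> {p, q, r} = R3_strands s a b c ea eb ec \<Longrightarrow>
    welded_move (u @ p @ v @ q @ x @ r @ y) (u @ rev p @ v @ rev q @ x @ rev r @ y)"
| F1: "gauss_diagram (u @ [Over c e, Over d e'] @ v) \<Longrightarrow>
    gauss_diagram (u @ [Over d e', Over c e] @ v) \<Longrightarrow>
    welded_move (u @ [Over c e, Over d e'] @ v) (u @ [Over d e', Over c e] @ v)"

definition welded_equiv :: "(passage list \<times> passage list) set" where
  "welded_equiv =
     {(w, w'). gauss_diagram w \<and> gauss_diagram w' \<and> equivclp welded_move w w'}"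

definition welded_knots :: "passage list set set" where
  "welded_knots = Collect gauss_diagram // welded_equiv"

definition trivial_knot :: "passage list set" where
  "trivial_knot = welded_equiv `` {[]}"


section \<open>Unknotting twist number\<close>

definition twist_at :: "nat \<Rightarrow> passage list \<Rightarrow> passage list" where
  "twist_at c w =
     map (\<lambda>x. case x of
            Over c' e \<Rightarrow> if c' = c then Under c' e else x
          | Under c' e \<Rightarrow> if c' = c then Over c' e else x) w"

definition twist :: "passage list \<Rightarrow> passage list \<Rightarrow> bool" where
  "twist w w' \<longleftrightarrow> (\<exists>c \<in> crossing ` set w. w' = twist_at c w)"

definition ut_diagram :: "passage list \<Rightarrow> nat" where
  "ut_diagram w = (LEAST n. \<exists>w' \<in> trivial_knot. (twist ^^ n) w w')"

definition ut_knot :: "passage list set \<Rightarrow> nat" where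
  "ut_knot K = (LEAST n. \<exists>w \<in> K. n = ut_diagram w)"


section \<open>Arcs and colorings\<close>

text \<open>The passages cut the curve into edges: edge \<open>i\<close> leaves passage \<open>i\<close> and runs to the cyclically
  next passage. A curve without passages is a single edge, numbered \<open>0\<close>. Edges are merged into
  arcs across overcrossings.\<close>

definition edges :: "passage list \<Rightarrow> nat set" where
  "edges w = {..< max 1 (length w)}"

definition in_edge :: "passage list \<Rightarrow> nat \<Rightarrow> nat" where
  "in_edge w i = (i + length w - 1) mod length w"

definition arc_of :: "passage list \<Rightarrow> nat \<Rightarrow> nat set" where
  "arc_of w k =
     {l. equivclp (\<lambda>k l. \<exists>i < length w. is_over (w ! i) \<and> k = in_edge w i \<and> l = i) k l}"

definition arcs :: "passage list \<Rightarrow> nat set set" where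
  "arcs w = arc_of w ` edges w"

definition alexander_op :: "('a, 'm) ring_scheme \<Rightarrow> 'a \<Rightarrow> 'a \<Rightarrow> 'a \<Rightarrow> 'a" where
  "alexander_op F t x y = t \<otimes>\<^bsub>F\<^esub> x \<oplus>\<^bsub>F\<^esub> (\<one>\<^bsub>F\<^esub> \<ominus>\<^bsub>F\<^esub> t) \<otimes>\<^bsub>F\<^esub> y"

text \<open>With (tangent, normal) positively oriented, the normal of the over-arc points to its left. At a
  positive crossing the under-strand passes from the right of the over-strand to its left, so
  \<open>\<alpha>\<close> is the incoming and \<open>\<gamma>\<close> the outgoing under-arc; at a negative crossing it is the other way
  round.\<close>

definition colorings :: "('a, 'm) ring_scheme \<Rightarrow> 'a \<Rightarrow> passage list \<Rightarrow> (nat set \<Rightarrow> 'a) set" where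
  "colorings F t w =
     {C \<in> arcs w \<rightarrow>\<^sub>E carrier F.
        \<forall>i < length w. \<forall>j < length w. \<forall>c e.
          w ! i = Under c e \<and> w ! j = Over c e \<longrightarrow>
          (let \<beta> = arc_of w j;
               \<alpha> = arc_of w (if e = 1 then in_edge w i else i);
               \<gamma> = arc_of w (if e = 1 then i else in_edge w i)
           in C \<gamma> = alexander_op F t (C \<alpha>) (C \<beta>))}"

definition Col ::
  "('a, 'm) ring_scheme \<Rightarrow> 'a \<Rightarrow> passage list \<Rightarrow> ('a, nat set \<Rightarrow> 'a) module" where
  "Col F t w =
     \<lparr>carrier = colorings F t w, monoid.mult = undefined, monoid.one = undefined,
      ring.zero = (\<lambda>a \<in> arcs w. \<zero>\<^bsub>F\<^esub>),
      ring.add = (\<lambda>C C'. \<lambda>a \<in> arcs w. C a \<oplus>\<^bsub>F\<^esub> C' a),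
      smult = (\<lambda>k C. \<lambda>a \<in> arcs w. k \<otimes>\<^bsub>F\<^esub> C a)\<rparr>"


section \<open>Laurent polynomials and their quotients\<close>

text \<open>A Laurent polynomial is given by its coefficient function.\<close>

definition laurent_ring :: "('a, 'm) ring_scheme \<Rightarrow> (int \<Rightarrow> 'a) ring" where
  "laurent_ring R =
     \<lparr>carrier = {g. range g \<subseteq> carrier R \<and> finite {i. g i \<noteq> \<zero>\<^bsub>R\<^esub>}},
      monoid.mult = (\<lambda>g h k. \<Oplus>\<^bsub>R\<^esub>i \<in> {i. g i \<noteq> \<zero>\<^bsub>R\<^esub>}. g i \<otimes>\<^bsub>R\<^esub> h (k - i)),
      monoid.one = (\<lambda>k. if k = 0 then \<one>\<^bsub>R\<^esub> else \<zero>\<^bsub>R\<^esub>),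
      ring.zero = (\<lambda>k. \<zero>\<^bsub>R\<^esub>),
      ring.add = (\<lambda>g h k. g k \<oplus>\<^bsub>R\<^esub> h k)\<rparr>"

definition laurent_var :: "('a, 'm) ring_scheme \<Rightarrow> int \<Rightarrow> 'a" where
  "laurent_var R = (\<lambda>k. if k = 1 then \<one>\<^bsub>R\<^esub> else \<zero>\<^bsub>R\<^esub>)"

text \<open>Degree normalised so as to be invariant under multiplication by the units \<open>c t\<^sup>k\<close>; it is the
  usual degree for polynomials in \<open>t\<close> with nonzero constant term.\<close>

definition laurent_degree :: "('a, 'm) ring_scheme \<Rightarrow> (int \<Rightarrow> 'a) \<Rightarrow> int" where
  "laurent_degree R g = Max {i. g i \<noteq> \<zero>\<^bsub>R\<^esub>} - Min {i. g i \<noteq> \<zero>\<^bsub>R\<^esub>}"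

abbreviation Lambda :: "nat \<Rightarrow> (int \<Rightarrow> int) ring" (\<open>\<Lambda>\<close>) where
  "\<Lambda> p \<equiv> laurent_ring (residue_ring (int p))"

abbreviation Lambda_t :: "nat \<Rightarrow> int \<Rightarrow> int" where
  "Lambda_t p \<equiv> laurent_var (residue_ring (int p))"

definition Fq :: "nat \<Rightarrow> (int \<Rightarrow> int) \<Rightarrow> (int \<Rightarrow> int) set ring" where
  "Fq p f = \<Lambda> p Quot (PIdl\<^bsub>\<Lambda> p\<^esub> f)"

definition Fq_t :: "nat \<Rightarrow> (int \<Rightarrow> int) \<Rightarrow> (int \<Rightarrow> int) set" where
  "Fq_t p f = (PIdl\<^bsub>\<Lambda> p\<^esub> f) +>\<^bsub>\<Lambda> p\<^esub> Lambda_t p"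

end

theory Submission
  imports Defs
begin

text \<open>The bound follows by counting colorings. Let \<open>q\<close> be the number of elements of the field; as the
  colorings of a diagram form a vector space, there are at least \<open>q\<close> to the power of its dimension.

  Their number does not change under welded moves, as for every quandle, except that reversing the
  direction of the curve replaces \<open>t\<close> by its inverse. Since diagrams carry no direction, the larger
  of the numbers for \<open>t\<close> and for \<open>1/t\<close> is used: this \<open>coloring_number\<close> is invariant
  (\<open>welded_equiv_coloring_number\<close>).

  A twist at a crossing \<open>c\<close> divides the number by at most \<open>q\<close>. If the two strands at \<open>c\<close> have the
  same color, then \<open>c\<close> imposes no further condition, neither before nor after the twist, so such a
  coloring is also one of the twisted diagram. The colorings with this property are the kernel of
  one linear functional and thus at least the \<open>q\<close>-th part of all (\<open>coloring_number_twist\<close>). The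
  diagram without crossings has \<open>q\<close> colorings, so a diagram that is unknotted by \<open>n\<close> twists has at
  most \<open>q ^ (n + 1)\<close>, and the dimension is at most \<open>n + 1\<close>.

  Two further points need a proof. The unknotting twist number is a minimum over a nonempty set,
  because twists make each diagram descending and a descending diagram is trivial
  (\<open>descending_by_twists\<close>, \<open>descending_trivial\<close>). And the quotient of the ring of Laurent
  polynomials is a finite field in which \<open>t\<close> is a unit, because that ring has a division with
  remainder whose remainders lie in a fixed finite window (\<open>laurent_divide\<close>).\<close>

section \<open>Gauss diagrams and welded equivalence\<close>

lemma gauss_diagram_mset:
  assumes "mset w = mset w'"
  shows "gauss_diagram w \<longleftrightarrow> gauss_diagram w'"
  using mset_eq_imp_distinct_iff[OF assms] mset_eq_setD[OF assms]
  unfolding gauss_diagram_def by simp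

lemma gauss_diagram_delete:
  assumes "gauss_diagram w" and "set w' = {x \<in> set w. crossing x \<noteq> c}" and "distinct w'"
  shows "gauss_diagram w'"
proof -
  have "x \<in> set w' \<longleftrightarrow> x \<in> set w \<and> crossing x \<noteq> c" for x using assms(2) by simp
  then have "\<And>c' e. Over c' e \<in> set w' \<longleftrightarrow> Over c' e \<in> set w \<and> c' \<noteq> c"
    "\<And>c' e. Under c' e \<in> set w' \<longleftrightarrow> Under c' e \<in> set w \<and> c' \<noteq> c"
    by simp_all
  then show ?thesis using assms(1,3) unfolding gauss_diagram_def by metis
qed

lemma gauss_diagram_letters:
  assumes "gauss_diagram w" "Over c e \<in> set w" "x \<in> set w" "crossing x = c"
  shows "x = Over c e \<or> x = Under c e"
proof (cases x)
  case (Over c' e')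
  then show ?thesis using assms by (auto simp: gauss_diagram_def)
next
  case (Under c' e')
  then show ?thesis using assms by (auto simp: gauss_diagram_def)
qed

lemma gauss_diagram_arrow:
  assumes "gauss_diagram w" "c \<in> crossing ` set w"
  obtains e where "Over c e \<in> set w" "Under c e \<in> set w"
proof -
  obtain y where y: "y \<in> set w" "crossing y = c" using assms(2) by blast
  show thesis
  proof (cases y)
    case (Over d e)
    then show ?thesis using that[of e] y assms(1) by (simp add: gauss_diagram_def)
  next
    case (Under d e)
    then show ?thesis using that[of e] y assms(1) by (simp add: gauss_diagram_def)
  qed
qed

section \<open>Unknotting by twists\<close>

definition flip_at :: "nat \<Rightarrow> passage \<Rightarrow> passage" where
  "flip_at c x = (case x of
            Over c' e \<Rightarrow> if c' = c then Under c' e else x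
          | Under c' e \<Rightarrow> if c' = c then Over c' e else x)"

lemma twist_at_flip: "twist_at c w = map (flip_at c) w"
  unfolding twist_at_def flip_at_def ..

lemma flip_at_simps [simp]:
  "flip_at c (Over c e) = Under c e"
  "flip_at c (Under c e) = Over c e"
  "crossing (flip_at c x) = crossing x"
  "flip_at c (flip_at c x) = x"
  by (auto simp: flip_at_def split: passage.splits)

lemma flip_at_other: "crossing x \<noteq> c \<Longrightarrow> flip_at c x = x"
  by (auto simp: flip_at_def split: passage.splits)

lemma twist_at_other: "c \<notin> crossing ` set w \<Longrightarrow> twist_at c w = w"
  unfolding twist_at_flip by (rule map_idI) (force intro: flip_at_other)

lemma gauss_diagram_twist_at:
  assumes "gauss_diagram w"
  shows "gauss_diagram (twist_at c w)"
proof -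
  have inj: "inj (flip_at c)" by (metis flip_at_simps(4) injI)
  have mem: "x \<in> set (twist_at c w) \<longleftrightarrow> flip_at c x \<in> set w" for x
    unfolding twist_at_flip by (metis flip_at_simps(4) image_eqI image_iff list.set_map)
  have O: "Over c' e \<in> set (twist_at c w) \<longleftrightarrow> Over c' e \<in> set w" for c' e
    unfolding mem using assms by (auto simp: flip_at_def gauss_diagram_def)
  have U: "Under c' e \<in> set (twist_at c w) \<longleftrightarrow> Under c' e \<in> set w" for c' e
    unfolding mem using assms by (auto simp: flip_at_def gauss_diagram_def)
  have "distinct (twist_at c w)"
    using assms inj unfolding twist_at_flip gauss_diagram_def
    by (simp add: distinct_map inj_on_subset[of _ UNIV])
  then show ?thesis using assms unfolding gauss_diagram_def O U by blast
qed

lemma gauss_diagram_twist: "twist w w' \<Longrightarrow> gauss_diagram w \<Longrightarrow> gauss_diagram w'"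
  unfolding twist_def using gauss_diagram_twist_at by auto

lemma gauss_diagram_twists: "(twist ^^ n) w w' \<Longrightarrow> gauss_diagram w \<Longrightarrow> gauss_diagram w'"
  by (induction n arbitrary: w') (auto intro: gauss_diagram_twist)

text \<open>The tail of every arrow is met before its head. This is the analogue, for a Gauss word with its
  base point, of a descending knot diagram.\<close>

definition descending :: "passage list \<Rightarrow> bool" where
  "descending w \<longleftrightarrow> (\<forall>u c e v. w = u @ Under c e # v \<longrightarrow> Over c e \<in> set u)"

lemma descending_snoc:
  assumes "descending u" and "\<And>c e. x = Under c e \<Longrightarrow> Over c e \<in> set u"
  shows "descending (u @ [x])"
  unfolding descending_def
proof (intro allI impI)
  fix u' c e v assume eq: "u @ [x] = u' @ Under c e # v"
  show "Over c e \<in> set u'"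
  proof (cases v rule: rev_cases)
    case Nil
    then show ?thesis using eq assms(2) by simp
  next
    case (snoc v' y)
    then have "u = u' @ Under c e # v'" using eq by simp
    then show ?thesis using assms(1) unfolding descending_def by blast
  qed
qed

text \<open>Read the word from left to right: whenever a head comes first, twisting its crossing puts the
  tail there instead and leaves the part \<open>u\<close> that was already read unchanged, because the crossing
  does not occur in \<open>u\<close>.\<close>

lemma descending_by_twists_aux:
  assumes "gauss_diagram (u @ v)" and "descending u"
  shows "\<exists>n w'. (twist ^^ n) (u @ v) w' \<and> descending w'"
  using assms
proof (induction "length v" arbitrary: u v)
  case 0
  then show ?case by (intro exI[of _ 0] exI[of _ "u @ v"]) auto
next
  case (Suc n)
  then obtain x v' where v: "v = x # v'" by (cases v) auto
  show ?case
  proof (cases "\<exists>c e. x = Under c e \<and> Over c e \<notin> set u")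
    case False
    then have "descending (u @ [x])" using Suc.prems by (auto intro: descending_snoc)
    then show ?thesis using Suc.hyps(1)[of v' "u @ [x]"] Suc.hyps(2) Suc.prems v by simp
  next
    case True
    then obtain c e where x: "x = Under c e" and no: "Over c e \<notin> set u" by blast
    have "c \<notin> crossing ` set u"
    proof
      assume "c \<in> crossing ` set u"
      then obtain y where y: "y \<in> set u" "crossing y = c" by auto
      have d: "Under c e \<notin> set u" using Suc.prems(1) v x by (auto simp: gauss_diagram_def)
      have "Over c e \<in> set (u @ v)" using Suc.prems(1) v x by (auto simp: gauss_diagram_def)
      moreover have "Under c e \<in> set (u @ v)" using v x by auto
      moreover have "y \<in> set (u @ v)" using y by simp
      ultimately have "y = Over c e \<or> y = Under c e"
        using gauss_diagram_letters[OF Suc.prems(1)] y(2) by blast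
      then show False using y d no by auto
    qed
    then have tw: "twist_at c (u @ v) = (u @ [Over c e]) @ twist_at c v'"
      using twist_at_other[of c u] by (simp add: twist_at_flip v x)
    have "twist (u @ v) (twist_at c (u @ v))"
      unfolding twist_def using v x by force
    moreover have "descending (u @ [Over c e])" using Suc.prems by (auto intro: descending_snoc)
    then obtain m w' where "(twist ^^ m) (twist_at c (u @ v)) w'" "descending w'"
      using Suc.hyps(1)[of "twist_at c v'" "u @ [Over c e]"] Suc.hyps(2) v
        gauss_diagram_twist_at[OF Suc.prems(1), of c] tw by (auto simp: twist_at_flip)
    ultimately show ?thesis by (metis relpowp_Suc_I2)
  qed
qed

lemma descending_by_twists:
  assumes "gauss_diagram w"
  shows "\<exists>n w'. (twist ^^ n) w w' \<and> descending w'"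
  using descending_by_twists_aux[of "[]" w] assms by (simp add: descending_def)

lemma slide_tail:
  assumes "gauss_diagram (u @ Over c e # y @ z)" and "\<forall>x \<in> set y. is_over x"
  shows "equivclp welded_move (u @ Over c e # y @ z) (u @ y @ Over c e # z)"
  using assms
proof (induction y arbitrary: u)
  case Nil
  then show ?case by simp
next
  case (Cons x y)
  then obtain d e' where x: "x = Over d e'" by (cases x) auto
  have g: "gauss_diagram ((u @ [x]) @ Over c e # y @ z)"
    using Cons.prems(1) by (subst gauss_diagram_mset[of _ "u @ Over c e # (x # y) @ z"]) auto
  have "welded_move (u @ [Over c e, Over d e'] @ (y @ z)) (u @ [Over d e', Over c e] @ (y @ z))"
    using Cons.prems(1) g x by (intro welded_move.F1) auto
  then have "equivclp welded_move (u @ Over c e # (x # y) @ z) ((u @ [x]) @ Over c e # y @ z)"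
    using x by auto
  moreover have "equivclp welded_move ((u @ [x]) @ Over c e # y @ z) ((u @ [x]) @ y @ Over c e # z)"
    using Cons.IH[OF g] Cons.prems(2) by simp
  ultimately show ?case by (metis append.assoc append_Cons append_Nil equivclp_trans)
qed

text \<open>Before the first head there are only tails, and F1 moves the tail of its arrow next to it; then
  R1 removes the arrow, whatever its sign, and the shorter word is still descending.\<close>

lemma descending_trivial:
  assumes "gauss_diagram w" and "descending w"
  shows "equivclp welded_move [] w"
  using assms
proof (induction "length w" arbitrary: w rule: less_induct)
  case less
  show ?case
  proof (cases "\<exists>x \<in> set w. \<not> is_over x")
    case False
    then have "set w = {}" 
      using less.prems(1) unfolding gauss_diagram_def
      by (metis equals0I is_over.elims(2) is_over.simps(2))
    then show ?thesis by simp
  next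
    case True
    then obtain u x v where w: "w = u @ x # v" "\<not> is_over x" and u: "\<forall>y\<in>set u. is_over y"
      using split_list_first_prop[of w "\<lambda>x. \<not> is_over x"] by blast
    obtain c e where x: "x = Under c e" using w(2) by (cases x) auto
    have "Over c e \<in> set u" using less.prems(2) w x by (auto simp: descending_def)
    then obtain u1 u2 where u12: "u = u1 @ Over c e # u2" by (meson split_list)
    (* F1 will move the tail next to the head, which makes ?z a kink that R1 removes *)
    let ?z = "[Over c e, Under c e]"
    have gm: "gauss_diagram ((u1 @ u2) @ ?z @ v)"
      using less.prems(1) by (subst gauss_diagram_mset[of _ w]) (auto simp: w x u12)
    have cn: "c \<notin> crossing ` set ((u1 @ u2) @ v)"
    proof
      assume "c \<in> crossing ` set ((u1 @ u2) @ v)"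
      then obtain y where y: "y \<in> set ((u1 @ u2) @ v)" "crossing y = c" by blast
      have "y = Over c e \<or> y = Under c e"
        using y by (intro gauss_diagram_letters[OF gm]) auto
      then show False using y gm by (auto simp: gauss_diagram_def)
    qed
    have g: "gauss_diagram ((u1 @ u2) @ v)"
    proof (rule gauss_diagram_delete[OF gm, of _ c])
      show "distinct ((u1 @ u2) @ v)" using gm by (auto simp: gauss_diagram_def)
      show "set ((u1 @ u2) @ v) = {x \<in> set ((u1 @ u2) @ ?z @ v). crossing x \<noteq> c}"
        using cn by auto
    qed
    have "descending ((u1 @ u2) @ v)" unfolding descending_def
    proof (intro allI impI)
      fix a d e' b assume eq: "(u1 @ u2) @ v = a @ Under d e' # b"
      have uo: "\<forall>y\<in>set (u1 @ u2). is_over y" using u u12 by auto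
      obtain v1 where v1: "a = (u1 @ u2) @ v1" "v = v1 @ Under d e' # b"
      proof -
        from eq consider (1) us where "u1 @ u2 = a @ us" "us @ v = Under d e' # b"
          | (2) us where "(u1 @ u2) @ us = a" "v = us @ Under d e' # b"
          unfolding append_eq_append_conv2 by blast
        then show ?thesis
        proof cases
          case 1
          show ?thesis
          proof (cases us)
            case Nil with 1 show ?thesis using that[of "[]"] by simp
          next
            case (Cons y ys)
            with 1 have "Under d e' \<in> set (u1 @ u2)" by simp
            then have "is_over (Under d e')" using uo by blast
            then show ?thesis by simp
          qed
        qed (use that in auto)
      qed
      have "Over d e' \<in> set (u @ Under c e # v1)"
        using less.prems(2) unfolding descending_def w x v1 by (metis append.assoc append_Cons)
      moreover have "d \<noteq> c" using cn v1 by force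
      ultimately show "Over d e' \<in> set a" using v1 u12 by auto
    qed
    then have "equivclp welded_move [] ((u1 @ u2) @ v)"
      by (intro less.hyps g) (simp_all add: w u12)
    moreover have "welded_move ((u1 @ u2) @ v) ((u1 @ u2) @ ?z @ v)"
      by (intro welded_move.R1 g gm) auto
    moreover have "equivclp welded_move w ((u1 @ u2) @ ?z @ v)"
      using slide_tail[of u1 c e u2 "Under c e # v"] less.prems(1) u by (simp add: w x u12)
    ultimately show ?thesis
      by (meson equivclp_sym equivclp_trans r_into_equivclp)
  qed
qed

text \<open>Every diagram can be unknotted by twists, so the minimum in the definition of the unknotting
  twist number is taken over a nonempty set and is attained.\<close>

lemma ut_diagram_attained:
  assumes "gauss_diagram w"
  shows "\<exists>w' \<in> trivial_knot. (twist ^^ ut_diagram w) w w'"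
proof -
  obtain n w' where w': "(twist ^^ n) w w'" "descending w'"
    using descending_by_twists[OF assms] by blast
  have "gauss_diagram w'" using gauss_diagram_twists[OF w'(1) assms] .
  moreover have "gauss_diagram []" by (simp add: gauss_diagram_def)
  ultimately have "w' \<in> trivial_knot"
    using descending_trivial w' unfolding trivial_knot_def welded_equiv_def by simp
  then show ?thesis
    using LeastI[of "\<lambda>n. \<exists>w' \<in> trivial_knot. (twist ^^ n) w w'" n] w'
    unfolding ut_diagram_def by blast
qed

lemma ut_knot_attained:
  assumes "D \<in> K"
  shows "\<exists>w \<in> K. ut_knot K = ut_diagram w"
  using LeastI[of "\<lambda>n. \<exists>w \<in> K. n = ut_diagram w" "ut_diagram D"] assms
  unfolding ut_knot_def by auto

lemma equiv_welded: "equiv (Collect gauss_diagram) welded_equiv"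
  unfolding welded_equiv_def
  by (intro equivI refl_onI symI transI) (auto intro: equivclp_sym equivclp_trans)

lemma welded_knot_members:
  assumes "K \<in> welded_knots" "D \<in> K" "w \<in> K"
  shows "gauss_diagram D" "gauss_diagram w" "equivclp welded_move D w"
  using in_quotient_imp_in_rel[OF equiv_welded, of K D w] assms
  by (auto simp: welded_knots_def welded_equiv_def)

text \<open>The two letters of a crossing are its only ones, so a part of the word that contains both keeps
  the crossing out of the rest.\<close>

lemma gauss_diagram_fresh:
  assumes "gauss_diagram w" and "mset w = mset (a @ b)"
    and "Over c e \<in> set a" and "Under c e \<in> set a"
  shows "c \<notin> crossing ` set b"
proof
  assume "c \<in> crossing ` set b"
  then obtain y where y: "y \<in> set b" "crossing y = c" by blast
  have g: "gauss_diagram (a @ b)" using gauss_diagram_mset[OF assms(2)] assms(1) by blast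
  have "y = Over c e \<or> y = Under c e"
    using y assms(3) by (intro gauss_diagram_letters[OF g]) auto
  then have "y \<in> set a" using assms(3,4) by blast
  then show False using y(1) g unfolding gauss_diagram_def by auto
qed

lemma gauss_diagram_sign:
  "gauss_diagram w \<Longrightarrow> Over c e \<in> set w \<Longrightarrow> e \<in> {1, -1}"
  unfolding gauss_diagram_def by blast

section \<open>Quandle colorings of Gauss words\<close>

text \<open>A coloring of a Gauss word is encoded without arcs, so that words can be cut and joined freely:
  \<open>g c\<close> is the color of the over-strand at the crossing \<open>c\<close>, and a color is carried along the word,
  changing only at heads. In \<open>act e x y\<close> the color \<open>x\<close> passes under \<open>y\<close> at a crossing of sign \<open>e\<close>.\<close>

fun pass :: "(int \<Rightarrow> 'a \<Rightarrow> 'a \<Rightarrow> 'a) \<Rightarrow> (nat \<Rightarrow> 'a) \<Rightarrow> 'a \<Rightarrow> passage \<Rightarrow> 'a" where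
  "pass act g x (Over c e) = x"
| "pass act g x (Under c e) = act e x (g c)"

abbreviation carry :: "(int \<Rightarrow> 'a \<Rightarrow> 'a \<Rightarrow> 'a) \<Rightarrow> (nat \<Rightarrow> 'a) \<Rightarrow> 'a \<Rightarrow> passage list \<Rightarrow> 'a" where
  "carry act g \<equiv> foldl (pass act g)"

fun fits :: "(int \<Rightarrow> 'a \<Rightarrow> 'a \<Rightarrow> 'a) \<Rightarrow> (nat \<Rightarrow> 'a) \<Rightarrow> 'a \<Rightarrow> passage list \<Rightarrow> bool" where
  "fits act g x [] = True"
| "fits act g x (p # w) = ((is_over p \<longrightarrow> g (crossing p) = x) \<and> fits act g (pass act g x p) w)"

text \<open>The last condition closes the curve: the color comes back to the base point unchanged.\<close>

definition is_coloring ::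
  "'a set \<Rightarrow> (int \<Rightarrow> 'a \<Rightarrow> 'a \<Rightarrow> 'a) \<Rightarrow> passage list \<Rightarrow> 'a \<Rightarrow> (nat \<Rightarrow> 'a) \<Rightarrow> bool" where
  "is_coloring Q act w x g \<longleftrightarrow>
     x \<in> Q \<and> g \<in> crossing ` set w \<rightarrow> Q \<and> fits act g x w \<and> carry act g x w = x"

definition word_colorings ::
  "'a set \<Rightarrow> (int \<Rightarrow> 'a \<Rightarrow> 'a \<Rightarrow> 'a) \<Rightarrow> passage list \<Rightarrow> ('a \<times> (nat \<Rightarrow> 'a)) set" where
  "word_colorings Q act w =
     {(x, g). is_coloring Q act w x g \<and> g \<in> extensional (crossing ` set w)}"

lemma fits_append:
  "fits act g x (u @ v) \<longleftrightarrow> fits act g x u \<and> fits act g (carry act g x u) v"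
  by (induction u arbitrary: x) auto

lemma pass_cong: "g (crossing p) = h (crossing p) \<Longrightarrow> pass act g x p = pass act h x p"
  by (cases p) auto

lemma carry_cong:
  "\<forall>c \<in> crossing ` set w. g c = h c \<Longrightarrow> carry act g x w = carry act h x w"
proof (induction w arbitrary: x)
  case (Cons p w)
  have "pass act g x p = pass act h x p" using Cons.prems by (intro pass_cong) auto
  then show ?case using Cons by simp
qed simp

lemma fits_cong:
  "\<forall>c \<in> crossing ` set w. g c = h c \<Longrightarrow> fits act g x w = fits act h x w"
proof (induction w arbitrary: x)
  case (Cons p w)
  have "pass act g x p = pass act h x p" using Cons.prems by (intro pass_cong) auto
  then show ?case using Cons by simp
qed simp

lemma is_coloring_cong:
  assumes "\<forall>c \<in> crossing ` set w. g c = h c"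
  shows "is_coloring Q act w x g \<longleftrightarrow> is_coloring Q act w x h"
proof -
  have "g \<in> crossing ` set w \<rightarrow> Q \<longleftrightarrow> h \<in> crossing ` set w \<rightarrow> Q" using assms by (auto simp: Pi_iff)
  then show ?thesis
    unfolding is_coloring_def fits_cong[OF assms] carry_cong[OF assms] by simp
qed

lemma is_coloring_restrict:
  assumes "is_coloring Q act w x g"
  shows "(x, restrict g (crossing ` set w)) \<in> word_colorings Q act w"
proof -
  have "is_coloring Q act w x (restrict g (crossing ` set w))"
    using assms is_coloring_cong[of w g "restrict g (crossing ` set w)"] by simp
  then show ?thesis by (simp add: word_colorings_def)
qed

text \<open>Exchanging the roles of the two signs is what reversing the direction of the curve does.\<close>

definition dual :: "(int \<Rightarrow> 'a \<Rightarrow> 'a \<Rightarrow> 'a) \<Rightarrow> int \<Rightarrow> 'a \<Rightarrow> 'a \<Rightarrow> 'a" where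
  "dual act e = act (- e)"

locale finite_quandle =
  fixes Q :: "'a set" and act :: "int \<Rightarrow> 'a \<Rightarrow> 'a \<Rightarrow> 'a"
  assumes finite_Q: "finite Q"
    and act_closed: "x \<in> Q \<Longrightarrow> y \<in> Q \<Longrightarrow> act e x y \<in> Q"
    and act_idem: "x \<in> Q \<Longrightarrow> act e x x = x"
    and act_cancel: "x \<in> Q \<Longrightarrow> y \<in> Q \<Longrightarrow> act (- e) (act e x y) y = x"
    and act_distrib: "x \<in> Q \<Longrightarrow> y \<in> Q \<Longrightarrow> z \<in> Q \<Longrightarrow>
      act e' (act e x z) y = act e (act e' x y) (act e' z y)"
begin

lemma finite_quandle_dual: "finite_quandle Q (dual act)"
  unfolding dual_def
  by unfold_locales (blast intro: finite_Q act_closed act_idem act_cancel act_distrib)+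

lemma act_cancel': "x \<in> Q \<Longrightarrow> y \<in> Q \<Longrightarrow> act e (act (- e) x y) y = x"
  using act_cancel[of x y "- e"] by simp

lemma pass_closed: "x \<in> Q \<Longrightarrow> g (crossing p) \<in> Q \<Longrightarrow> pass act g x p \<in> Q"
  by (cases p) (auto intro: act_closed)

lemma carry_closed: "x \<in> Q \<Longrightarrow> g \<in> crossing ` set w \<rightarrow> Q \<Longrightarrow> carry act g x w \<in> Q"
proof (induction w arbitrary: x)
  case (Cons p w)
  then have "pass act g x p \<in> Q" by (intro pass_closed) auto
  then show ?case using Cons by simp
qed simp

lemma finite_word_colorings: "finite (word_colorings Q act w)"
proof (rule finite_subset)
  show "word_colorings Q act w \<subseteq> Q \<times> (crossing ` set w \<rightarrow>\<^sub>E Q)"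
    by (auto simp: word_colorings_def is_coloring_def PiE_def)
  show "finite (Q \<times> (crossing ` set w \<rightarrow>\<^sub>E Q))"
    using finite_Q by (intro finite_cartesian_product finite_PiE) auto
qed

text \<open>The moves that change the arrows are compared by maps \<open>(x, g) \<mapsto> (F x g, G x g)\<close> of colorings from
  which the start color and the colors of the crossings of \<open>w\<close> can be recovered. The functions
  \<open>g\<close> matter only on the crossings of the word, which avoids restrictions in the applications.\<close>

lemma card_word_colorings_le:
  assumes col: "\<And>x g. is_coloring Q act w x g \<Longrightarrow> is_coloring Q act' w' (F x g) (G x g)"
    and inj: "\<And>x g y h. is_coloring Q act w x g \<Longrightarrow> is_coloring Q act w y h \<Longrightarrow>
      F x g = F y h \<Longrightarrow> \<forall>c \<in> crossing ` set w'. G x g c = G y h c \<Longrightarrow>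
      x = y \<and> (\<forall>c \<in> crossing ` set w. g c = h c)"
    and fin: "finite (word_colorings Q act' w')"
  shows "card (word_colorings Q act w) \<le> card (word_colorings Q act' w')"
proof (rule card_inj_on_le[OF _ _ fin])
  define \<Phi> where "\<Phi> = (\<lambda>(x, g). (F x g, restrict (G x g) (crossing ` set w')))"
  show "\<Phi> ` word_colorings Q act w \<subseteq> word_colorings Q act' w'"
    using is_coloring_restrict[OF col] by (auto simp: \<Phi>_def word_colorings_def)
  show "inj_on \<Phi> (word_colorings Q act w)"
  proof (rule inj_onI, clarify)
    fix x g y h
    assume 1: "(x, g) \<in> word_colorings Q act w" "(y, h) \<in> word_colorings Q act w"
      and eq: "\<Phi> (x, g) = \<Phi> (y, h)"
    from 1 have cols: "is_coloring Q act w x g" "is_coloring Q act w y h"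
      and ext: "g \<in> extensional (crossing ` set w)" "h \<in> extensional (crossing ` set w)"
      by (auto simp: word_colorings_def)
    from eq have F: "F x g = F y h"
      and "restrict (G x g) (crossing ` set w') = restrict (G y h) (crossing ` set w')"
      by (auto simp: \<Phi>_def)
    then have "\<forall>c \<in> crossing ` set w'. G x g c = G y h c" by (metis restrict_apply')
    then have "x = y \<and> (\<forall>c \<in> crossing ` set w. g c = h c)" by (rule inj[OF cols F])
    then show "x = y \<and> g = h" using extensionalityI[OF ext] by blast
  qed
qed

section \<open>Base point, crossing names and direction\<close>

lemma card_word_colorings_rotate:
  "card (word_colorings Q act (rotate1 w)) = card (word_colorings Q act w)"
proof (cases w)
  case (Cons p u)
  have X: "crossing ` set (rotate1 w) = crossing ` set w" by simp
  have fwd: "is_coloring Q act (u @ [p]) (pass act g x p) g" if "is_coloring Q act (p # u) x g" for x g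
  proof -
    have "pass act g x p \<in> Q" using that by (intro pass_closed) (auto simp: is_coloring_def)
    then show ?thesis using that by (auto simp: is_coloring_def fits_append)
  qed
  have bwd: "is_coloring Q act (p # u) (carry act g x u) g" if "is_coloring Q act (u @ [p]) x g" for x g
  proof -
    have "carry act g x u \<in> Q" using that by (intro carry_closed) (auto simp: is_coloring_def)
    then show ?thesis using that by (auto simp: is_coloring_def fits_append)
  qed
  have "card (word_colorings Q act (p # u)) \<le> card (word_colorings Q act (u @ [p]))"
  proof (rule card_word_colorings_le[where F = "\<lambda>x g. pass act g x p" and G = "\<lambda>x g. g"])
    fix x g y h
    assume a: "is_coloring Q act (p # u) x g" "is_coloring Q act (p # u) y h"
      "pass act g x p = pass act h y p" "\<forall>c \<in> crossing ` set (u @ [p]). g c = h c"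
    then have "x = carry act g (pass act g x p) u" "y = carry act h (pass act h y p) u"
      by (auto simp: is_coloring_def)
    moreover have "carry act g (pass act g x p) u = carry act h (pass act g x p) u"
      using a(4) by (intro carry_cong) auto
    ultimately show "x = y \<and> (\<forall>c \<in> crossing ` set (p # u). g c = h c)" using a(3,4) by auto
  qed (use fwd finite_word_colorings in auto)
  moreover have "card (word_colorings Q act (u @ [p])) \<le> card (word_colorings Q act (p # u))"
  proof (rule card_word_colorings_le[where F = "\<lambda>x g. carry act g x u" and G = "\<lambda>x g. g"])
    fix x g y h
    assume a: "is_coloring Q act (u @ [p]) x g" "is_coloring Q act (u @ [p]) y h"
      "carry act g x u = carry act h y u" "\<forall>c \<in> crossing ` set (p # u). g c = h c"
    then have "x = pass act g (carry act g x u) p" "y = pass act h (carry act h y u) p"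
      by (auto simp: is_coloring_def)
    moreover have "pass act g (carry act g x u) p = pass act h (carry act g x u) p"
      using a(4) by (intro pass_cong) auto
    ultimately show "x = y \<and> (\<forall>c \<in> crossing ` set (u @ [p]). g c = h c)" using a(3,4) by auto
  qed (use bwd finite_word_colorings in auto)
  ultimately show ?thesis using Cons by simp
qed simp

lemma pass_relabel: "pass act g x (relabel \<pi> p) = pass act (g \<circ> \<pi>) x p"
  by (cases p) auto

lemma crossing_relabel [simp]: "crossing (relabel \<pi> p) = \<pi> (crossing p)"
  by (cases p) auto

lemma is_over_relabel [simp]: "is_over (relabel \<pi> p) = is_over p"
  by (cases p) auto

lemma is_coloring_relabel:
  "is_coloring Q act (map (relabel \<pi>) w) x g \<longleftrightarrow> is_coloring Q act w x (g \<circ> \<pi>)"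
proof -
  have "fits act g x (map (relabel \<pi>) w) \<longleftrightarrow> fits act (g \<circ> \<pi>) x w" for x
    by (induction w arbitrary: x) (auto simp: pass_relabel)
  moreover have "carry act g x (map (relabel \<pi>) w) = carry act (g \<circ> \<pi>) x w"
    by (induction w arbitrary: x) (auto simp: pass_relabel)
  moreover have "g \<in> crossing ` set (map (relabel \<pi>) w) \<rightarrow> Q \<longleftrightarrow> g \<circ> \<pi> \<in> crossing ` set w \<rightarrow> Q"
    by (simp add: Pi_iff image_image)
  ultimately show ?thesis by (simp add: is_coloring_def)
qed

lemma card_word_colorings_relabel:
  assumes "inj \<pi>"
  shows "card (word_colorings Q act (map (relabel \<pi>) w)) = card (word_colorings Q act w)"
proof (rule antisym)
  show "card (word_colorings Q act (map (relabel \<pi>) w)) \<le> card (word_colorings Q act w)"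
    by (rule card_word_colorings_le[where F = "\<lambda>x g. x" and G = "\<lambda>x g. g \<circ> \<pi>"])
       (auto simp: is_coloring_relabel finite_word_colorings)
  have c: "g \<circ> inv_into UNIV \<pi> \<circ> \<pi> = g" for g :: "nat \<Rightarrow> 'a" using assms by (auto simp: fun_eq_iff)
  show "card (word_colorings Q act w) \<le> card (word_colorings Q act (map (relabel \<pi>) w))"
    by (rule card_word_colorings_le[where F = "\<lambda>x g. x" and G = "\<lambda>x g. g \<circ> inv_into UNIV \<pi>"])
       (auto simp: is_coloring_relabel finite_word_colorings c assms)
qed

text \<open>Walking backwards undoes each change of color, with the opposite sign.\<close>

lemma carry_dual:
  assumes "x \<in> Q" "g \<in> crossing ` set w \<rightarrow> Q"
  shows "carry (dual act) g (carry act g x w) (rev w) = x \<and>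
    (fits act g x w \<longrightarrow> fits (dual act) g (carry act g x w) (rev w))"
  using assms
proof (induction w arbitrary: x)
  case (Cons p w)
  have q: "pass act g x p \<in> Q" using Cons.prems by (intro pass_closed) auto
  have "pass (dual act) g (pass act g x p) p = x"
    using Cons.prems by (cases p) (auto simp: dual_def act_cancel)
  moreover have "is_over p \<Longrightarrow> pass act g x p = x" by (cases p) auto
  ultimately show ?case
    using Cons.IH[OF q] Cons.prems q by (auto simp: fits_append)
qed auto

lemma word_colorings_rev_subset:
  "word_colorings Q act w \<subseteq> word_colorings Q (dual act) (rev w)"
proof clarify
  fix x g assume "(x, g) \<in> word_colorings Q act w"
  then show "(x, g) \<in> word_colorings Q (dual act) (rev w)"
    using carry_dual[of x g w] by (simp add: word_colorings_def is_coloring_def)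
qed

lemma word_colorings_rev:
  "word_colorings Q act w = word_colorings Q (dual act) (rev w)"
proof
  interpret d: finite_quandle Q "dual act" by (rule finite_quandle_dual)
  have "dual (dual act) = act" by (auto simp: dual_def)
  then show "word_colorings Q (dual act) (rev w) \<subseteq> word_colorings Q act w"
    using d.word_colorings_rev_subset[of "rev w"] by simp
qed (rule word_colorings_rev_subset)

section \<open>Invariance under the Reidemeister moves and F1\<close>

text \<open>An arrow between adjacent letters is satisfied exactly if its color is the color \<open>z\<close> at this
  place, by idempotence, and then it has no effect; so R1 adds one color that is determined by the
  others.\<close>

lemma kink:
  assumes "p = [Over c e, Under c e] \<or> p = [Under c e, Over c e]" "z \<in> Q" "g c \<in> Q"
  shows "fits act g z p \<longleftrightarrow> g c = z" and "g c = z \<Longrightarrow> carry act g z p = z"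
proof -
  have "g c = act e z (g c) \<longleftrightarrow> g c = z"
    using act_cancel[OF assms(2,3), of e] act_idem[OF assms(3), of "- e"] act_idem[OF assms(3), of e]
    by metis
  then show "fits act g z p \<longleftrightarrow> g c = z" using assms(1) by auto
  show "g c = z \<Longrightarrow> carry act g z p = z" using assms act_idem by auto
qed

lemma card_word_colorings_R1:
  assumes gd: "gauss_diagram (u @ p @ v)"
    and p: "p = [Over c e, Under c e] \<or> p = [Under c e, Over c e]"
  shows "card (word_colorings Q act (u @ p @ v)) = card (word_colorings Q act (u @ v))"
proof (rule antisym)
  have c: "c \<notin> crossing ` set (u @ v)"
    using p by (intro gauss_diagram_fresh[OF gd, of p _ c e]) auto
  have Xp: "crossing ` set p = {c}" using p by auto
  have X: "crossing ` set (u @ p @ v) = insert c (crossing ` set (u @ v))"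
    unfolding set_append image_Un Xp by blast
  have split: "is_coloring Q act (u @ p @ v) x g \<longleftrightarrow>
      is_coloring Q act (u @ v) x g \<and> g c = carry act g x u" for x g
  proof (cases "x \<in> Q \<and> g \<in> crossing ` set (u @ v) \<rightarrow> Q")
    case True
    then have z: "carry act g x u \<in> Q" by (intro carry_closed) auto
    show ?thesis
      using kink[OF p z, of g] True z by (auto simp: is_coloring_def fits_append image_Un Xp)
  qed (auto simp: is_coloring_def)
  show "card (word_colorings Q act (u @ p @ v)) \<le> card (word_colorings Q act (u @ v))"
  proof (rule card_word_colorings_le[where F = "\<lambda>x g. x" and G = "\<lambda>x g. g"])
    fix x g y h
    assume a: "is_coloring Q act (u @ p @ v) x g" "is_coloring Q act (u @ p @ v) y h" "x = y"
      "\<forall>c \<in> crossing ` set (u @ v). g c = h c"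
    then have "carry act g x u = carry act h y u" using carry_cong[of u g h act x] by auto
    then show "x = y \<and> (\<forall>c \<in> crossing ` set (u @ p @ v). g c = h c)"
      using a unfolding X by (auto simp: split)
  qed (auto simp: split finite_word_colorings)
  show "card (word_colorings Q act (u @ v)) \<le> card (word_colorings Q act (u @ p @ v))"
  proof (rule card_word_colorings_le[where F = "\<lambda>x g. x" and G = "\<lambda>x g. g(c := carry act g x u)"])
    fix x g assume a: "is_coloring Q act (u @ v) x g"
    let ?h = "g(c := carry act g x u)"
    have "is_coloring Q act (u @ v) x ?h"
      using a c by (subst is_coloring_cong[of _ _ g]) auto
    moreover have "carry act ?h x u = carry act g x u" using c by (intro carry_cong) auto
    ultimately show "is_coloring Q act (u @ p @ v) x ?h" by (simp add: split)
  qed (use c in \<open>auto simp: finite_word_colorings split: if_splits\<close>)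
qed

text \<open>Two arrows of opposite signs with adjacent tails have the same color and cancel where they are
  passed under.\<close>

lemma bigon:
  assumes po: "po = [Over c e, Over d (- e)]"
    and pu: "pu = [Under c e, Under d (- e)] \<or> pu = [Under d (- e), Under c e]"
  shows "fits act g z po \<longleftrightarrow> g c = z \<and> g d = z"
    and "carry act g z po = z"
    and "fits act g z pu"
    and "z \<in> Q \<Longrightarrow> g c \<in> Q \<Longrightarrow> g c = g d \<Longrightarrow> carry act g z pu = z"
  using pu act_cancel[of z "g c" e] act_cancel'[of z "g c" e] by (auto simp: po)

lemma card_word_colorings_R2:
  assumes gd: "gauss_diagram (u @ p @ v @ q @ x)"
    and po: "po = [Over c e, Over d (- e)]"
    and pu: "pu = [Under c e, Under d (- e)] \<or> pu = [Under d (- e), Under c e]"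
    and pq: "p = po \<and> q = pu \<or> p = pu \<and> q = po"
  shows "card (word_colorings Q act (u @ p @ v @ q @ x)) = card (word_colorings Q act (u @ v @ x))"
proof (rule antisym)
  (* the two new crossings have the color that is found after l, in front of the over-strand *)
  define l where "l = (if p = po then u else u @ v)"
  have c: "c \<notin> crossing ` set (u @ v @ x)"
    using pq po pu by (intro gauss_diagram_fresh[OF gd, of "p @ q" _ c e]) auto
  have d: "d \<notin> crossing ` set (u @ v @ x)"
    using pq po pu by (intro gauss_diagram_fresh[OF gd, of "p @ q" _ d "- e"]) auto
  have X: "crossing ` set (p @ q) = {c, d}" using pq po pu by auto
  have X'': "crossing ` set (u @ p @ v @ q @ x) = insert c (insert d (crossing ` set (u @ v @ x)))"
    using X unfolding set_append image_Un by blast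
  have ne: "po \<noteq> pu" using po pu by auto
  have split: "is_coloring Q act (u @ p @ v @ q @ x) b g \<longleftrightarrow>
      is_coloring Q act (u @ v @ x) b g \<and> g c = carry act g b l \<and> g d = carry act g b l" for b g
  proof (cases "b \<in> Q \<and> g \<in> crossing ` set (u @ v @ x) \<rightarrow> Q \<and> g c \<in> Q \<and> g d \<in> Q")
    case True
    have X': "g \<in> crossing ` set (u @ p @ v @ q @ x) \<rightarrow> Q" using True X by auto
    have z: "carry act g b u \<in> Q" "carry act g b (u @ v) \<in> Q"
      using True by (intro carry_closed; auto)+
    note [simp] = bigon(1,2,3)[OF po pu]
    note bg = bigon(4)[OF po pu]
    from pq show ?thesis
    proof
      assume p: "p = po \<and> q = pu"
      show ?thesis
      proof (cases "g c = carry act g b u \<and> g d = carry act g b u")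
        case True': True
        then show ?thesis
          using True X' z p bg[of "carry act g b (u @ v)" g]
          by (auto simp: is_coloring_def fits_append l_def)
      next
        case False
        then show ?thesis using p by (auto simp: is_coloring_def fits_append l_def)
      qed
    next
      assume p: "p = pu \<and> q = po"
      show ?thesis
      proof (cases "g c = g d")
        case True': True
        then show ?thesis
          using True X' z p bg[of "carry act g b u" g] ne
          by (auto simp: is_coloring_def fits_append l_def)
      next
        case False
        then show ?thesis using p by (auto simp: is_coloring_def fits_append l_def)
      qed
    qed
  next
    case False
    have "carry act g b l \<in> Q" if "is_coloring Q act (u @ v @ x) b g"
      using that by (intro carry_closed) (auto simp: is_coloring_def l_def split: if_splits)
    moreover have "\<not> is_coloring Q act (u @ p @ v @ q @ x) b g"
      using False unfolding is_coloring_def X'' Pi_iff by blast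
    moreover have "\<not> (is_coloring Q act (u @ v @ x) b g \<and> g c \<in> Q \<and> g d \<in> Q)"
      using False unfolding is_coloring_def by blast
    ultimately show ?thesis by metis
  qed
  have lX: "crossing ` set l \<subseteq> crossing ` set (u @ v @ x)" by (auto simp: l_def)
  show "card (word_colorings Q act (u @ p @ v @ q @ x)) \<le> card (word_colorings Q act (u @ v @ x))"
  proof (rule card_word_colorings_le[where F = "\<lambda>x g. x" and G = "\<lambda>x g. g"])
    fix b g b' h
    assume a: "is_coloring Q act (u @ p @ v @ q @ x) b g" "is_coloring Q act (u @ p @ v @ q @ x) b' h"
      "b = b'" "\<forall>c \<in> crossing ` set (u @ v @ x). g c = h c"
    then have "carry act g b l = carry act h b' l" using carry_cong[of l g h act b] lX by blast
    then show "b = b' \<and> (\<forall>c \<in> crossing ` set (u @ p @ v @ q @ x). g c = h c)"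
      using a unfolding X'' by (auto simp: split)
  qed (auto simp: split finite_word_colorings)
  show "card (word_colorings Q act (u @ v @ x)) \<le> card (word_colorings Q act (u @ p @ v @ q @ x))"
  proof (rule card_word_colorings_le[where F = "\<lambda>x g. x"
        and G = "\<lambda>x g. g(c := carry act g x l, d := carry act g x l)"])
    fix b g assume a: "is_coloring Q act (u @ v @ x) b g"
    let ?h = "g(c := carry act g b l, d := carry act g b l)"
    have "is_coloring Q act (u @ v @ x) b ?h"
      using a c d by (subst is_coloring_cong[of _ _ g]) auto
    moreover have "carry act ?h b l = carry act g b l" using c d lX by (intro carry_cong) auto
    ultimately show "is_coloring Q act (u @ p @ v @ q @ x) b ?h" by (simp add: split)
  next
    fix b g b' h
    assume *: "b = b'" "\<forall>i \<in> crossing ` set (u @ p @ v @ q @ x).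
        (g(c := carry act g b l, d := carry act g b l)) i =
        (h(c := carry act h b' l, d := carry act h b' l)) i"
    have "g i = h i" if "i \<in> crossing ` set (u @ v @ x)" for i
    proof -
      have "i \<noteq> c" "i \<noteq> d" using that c d by auto
      moreover have "i \<in> crossing ` set (u @ p @ v @ q @ x)" using that by auto
      note bspec[OF *(2) this]
      ultimately show ?thesis by simp
    qed
    then show "b = b' \<and> (\<forall>c \<in> crossing ` set (u @ v @ x). g c = h c)" using * by simp
  qed (rule finite_word_colorings)
qed

text \<open>Under the move only the color of \<open>c\<close> changes, since the middle strand meets \<open>c\<close> on the other side
  of the top strand, whose color is \<open>g a = g b\<close>. The new color is \<open>act (- s) (g c) (g a)\<close>
  for each choice of the crossing signs. That the bottom strand then leaves with the same color as
  before is self-distributivity.\<close>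

lemma R3_strand:
  assumes signs: "s \<in> {1, -1}" "ea \<in> {1, -1}" "eb \<in> {1, -1}" "ec \<in> {1, -1}"
    and st: "st \<in> R3_strands s a b c ea eb ec"
    and ne: "a \<noteq> c" "b \<noteq> c"
    and Q: "z \<in> Q" "g a \<in> Q" "g c \<in> Q" and ab: "g a = g b"
    and fits: "fits act g z st"
  defines "h \<equiv> g(c := act (- s) (g c) (g a))"
  shows "fits act h z (rev st) \<and> carry act h z (rev st) = carry act g z st"
proof -
  have h: "h a = g a" "h b = g a" "h c = act (- s) (g c) (g a)" using ne ab by (auto simp: h_def)
  note Q' = Q act_closed[OF Q(1,2)] act_closed[OF Q(1,3)]
  consider "st = directed (s * ea * eb * ec) [Over a ea, Over b eb]"
    | "st = directed (s * ea) [Under a ea, Over c ec]"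
    | "st = directed (s * eb) [Under b eb, Under c ec]"
    using st by (auto simp: R3_strands_def)
  then show ?thesis
  proof cases
    case 1
    then show ?thesis using fits ab by (auto simp: h directed_def split: if_splits)
  next
    case 2
    show ?thesis
    proof (cases "ea = s")
      case True
      then have "st = [Under a ea, Over c ec]" using 2 signs by (auto simp: directed_def)
      then show ?thesis using fits True Q by (auto simp: h act_cancel)
    next
      case False
      then have "ea = - s" "st = [Over c ec, Under a ea]" using 2 signs by (auto simp: directed_def)
      then show ?thesis using fits by (auto simp: h)
    qed
  next
    case 3
    show ?thesis
    proof (cases "eb = s")
      case True
      then have st: "st = [Under b eb, Under c ec]" using 3 signs by (auto simp: directed_def)
      have "act eb (act ec z (act (- s) (g c) (g a))) (g a) = act ec (act eb z (g a)) (g c)"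
        using act_distrib[of z "g a" "act (- s) (g c) (g a)" eb ec] Q act_cancel'[of "g c" "g a" s]
        by (simp add: True act_closed)
      then show ?thesis using st by (simp add: h ab[symmetric])
    next
      case False
      then have st: "eb = - s" "st = [Under c ec, Under b eb]" using 3 signs by (auto simp: directed_def)
      have "act ec (act eb z (g a)) (act (- s) (g c) (g a)) = act eb (act ec z (g c)) (g a)"
        using act_distrib[of z "g a" "g c" eb ec] Q by (simp add: st)
      then show ?thesis using st(2) by (simp add: h ab[symmetric])
    qed
  qed
qed

lemma card_word_colorings_R3_le:
  assumes gd: "gauss_diagram (u @ p @ v @ q @ x @ r @ y)"
    and s: "s \<in> {1, -1}"
    and pqr: "{p, q, r} = R3_strands s a b c ea eb ec"
  shows "card (word_colorings Q act (u @ p @ v @ q @ x @ r @ y))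
    \<le> card (word_colorings Q act (u @ rev p @ v @ rev q @ x @ rev r @ y))"
    (is "card (word_colorings Q act ?w) \<le> card (word_colorings Q act ?w')")
proof -
  have set_directed: "set (directed k xs) = set xs" for k and xs :: "passage list"
    by (simp add: directed_def)
  define T M B where "T = directed (s * ea * eb * ec) [Over a ea, Over b eb]"
    and "M = directed (s * ea) [Under a ea, Over c ec]"
    and "B = directed (s * eb) [Under b eb, Under c ec]"
  have pqr': "{p, q, r} = {T, M, B}" using pqr by (simp add: R3_strands_def T_def M_def B_def)
  have sets: "set T = {Over a ea, Over b eb}" "set M = {Under a ea, Over c ec}"
    "set B = {Under b eb, Under c ec}"
    by (auto simp: T_def M_def B_def set_directed)
  have dist: "distinct ?w" using gd by (simp add: gauss_diagram_def)
  have "(\<Union>st \<in> {p, q, r}. set st) = (\<Union>st \<in> {T, M, B}. set st)" using pqr' by simp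
  then have letters: "set (p @ q @ r) = {Over a ea, Over b eb, Under a ea, Over c ec, Under b eb, Under c ec}"
    using sets by auto
  have fresh: "c \<notin> crossing ` set (u @ v @ x @ y)"
    using letters by (intro gauss_diagram_fresh[OF gd, of "p @ q @ r" _ c ec]) auto
  have signs: "ea \<in> {1, -1}" "eb \<in> {1, -1}" "ec \<in> {1, -1}"
  proof -
    have "set (p @ q @ r) \<subseteq> set ?w" by auto
    then have "Over a ea \<in> set ?w" "Over b eb \<in> set ?w" "Over c ec \<in> set ?w"
      unfolding letters by auto
    then show "ea \<in> {1, -1}" "eb \<in> {1, -1}" "ec \<in> {1, -1}"
      using gd unfolding gauss_diagram_def by blast+
  qed
  have "T \<noteq> M" using sets by auto
  moreover have "T \<in> {p, q, r}" "M \<in> {p, q, r}" using pqr' by auto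
  moreover have "set p \<inter> set q = {}" "set p \<inter> set r = {}" "set q \<inter> set r = {}" using dist by auto
  ultimately have disj: "set T \<inter> set M = {}" by (auto simp: Int_commute)
  have sub: "set T \<subseteq> set ?w" "set M \<subseteq> set ?w" using \<open>T \<in> _\<close> \<open>M \<in> _\<close> by auto
  have ne: "a \<noteq> c" "b \<noteq> c"
  proof -
    have "e = ec" if "Over c e \<in> set ?w" for e
      using that gd sub(2) sets(2) unfolding gauss_diagram_def by blast
    moreover have "Over a ea \<in> set ?w" "Over b eb \<in> set ?w" using sub(1) sets(1) by auto
    ultimately show "a \<noteq> c" "b \<noteq> c" using disj sets by auto
  qed
  have Xw: "crossing ` set ?w' = crossing ` set ?w" by simp
  have abc: "a \<in> crossing ` set ?w" "b \<in> crossing ` set ?w" "c \<in> crossing ` set ?w"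
  proof -
    have "crossing ` set (p @ q @ r) \<subseteq> crossing ` set ?w" by auto
    then show "a \<in> crossing ` set ?w" "b \<in> crossing ` set ?w" "c \<in> crossing ` set ?w"
      unfolding letters by auto
  qed
  define H where "H = (\<lambda>g. g(c := act (- s) (g c) (g a)))"
  (* both tails lie on the top strand *)
  have ab: "g a = g b" if "is_coloring Q act ?w z g" for z g
  proof -
    have "\<exists>z'. fits act g z' T"
      using that \<open>T \<in> {p, q, r}\<close> unfolding is_coloring_def fits_append by blast
    then show ?thesis by (auto simp: T_def directed_def split: if_splits)
  qed
  have col: "is_coloring Q act ?w' z (H g)" if "is_coloring Q act ?w z g" for z g
  proof -
    have gQ: "g \<in> crossing ` set ?w \<rightarrow> Q" "z \<in> Q" using that by (auto simp: is_coloring_def)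
    note Q = funcset_mem[OF gQ(1) abc(1)] funcset_mem[OF gQ(1) abc(3)]
    have HQ: "H g \<in> crossing ` set ?w' \<rightarrow> Q"
      unfolding Xw
    proof (rule Pi_I)
      fix i assume "i \<in> crossing ` set ?w"
      then show "H g i \<in> Q"
        using funcset_mem[OF gQ(1)] act_closed[OF Q(2,1)] by (cases "i = c") (simp_all add: H_def)
    qed
    have keep: "carry act (H g) k l = carry act g k l" "fits act (H g) k l = fits act g k l"
      if "l \<in> {u, v, x, y}" for k l
    proof -
      have "crossing ` set l \<subseteq> crossing ` set (u @ v @ x @ y)" using that by auto
      then have "\<forall>i \<in> crossing ` set l. H g i = g i" using fresh by (auto simp: H_def)
      then show "carry act (H g) k l = carry act g k l" "fits act (H g) k l = fits act g k l"
        by (rule carry_cong, rule fits_cong)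
    qed
    have strand: "fits act (H g) k (rev st) \<and> carry act (H g) k (rev st) = carry act g k st"
      if "st \<in> {p, q, r}" "k \<in> Q" "fits act g k st" for k st
      unfolding H_def using that(1) unfolding pqr
      by (rule R3_strand[OF s signs _ ne that(2) Q ab[OF \<open>is_coloring Q act ?w z g\<close>] that(3)])
    (* the colors at the cuts between the seven parts, the same before and after the move *)
    define k1 k2 k3 k4 k5 where "k1 = carry act g z u" and "k2 = carry act g k1 p"
      and "k3 = carry act g k2 v" and "k4 = carry act g k3 q" and "k5 = carry act g k4 x"
    have kQ: "k1 \<in> Q" "k2 \<in> Q" "k3 \<in> Q" "k4 \<in> Q" "k5 \<in> Q"
      unfolding k1_def k2_def k3_def k4_def k5_def using gQ by (intro carry_closed; auto)+
    have "fits act g k1 p" "fits act g k3 q" "fits act g k5 r"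
      using that by (auto simp: is_coloring_def fits_append k1_def k2_def k3_def k4_def k5_def)
    note st = strand[OF _ kQ(1) this(1)] strand[OF _ kQ(3) this(2)] strand[OF _ kQ(5) this(3)]
    show ?thesis
      using that st HQ
      by (simp add: is_coloring_def fits_append keep k1_def k2_def k3_def k4_def k5_def)
  qed
  show ?thesis
  proof (rule card_word_colorings_le[where F = "\<lambda>x g. x" and G = "\<lambda>x g. H g"])
    fix z g z' h
    assume cols: "is_coloring Q act ?w z g" "is_coloring Q act ?w z' h" and "z = z'"
      and eq: "\<forall>i \<in> crossing ` set ?w'. H g i = H h i"
    have eq': "H g i = H h i" if "i \<in> crossing ` set ?w" for i using eq that unfolding Xw by blast
    have a: "g a = h a" using eq'[OF abc(1)] ne by (simp add: H_def)
    have "g \<in> crossing ` set ?w \<rightarrow> Q" "h \<in> crossing ` set ?w \<rightarrow> Q"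
      using cols unfolding is_coloring_def by blast+
    note hQ = funcset_mem[OF this(1) abc(1)] funcset_mem[OF this(1) abc(3)] funcset_mem[OF this(2) abc(3)]
    have "act (- s) (g c) (g a) = act (- s) (h c) (g a)"
      using eq'[OF abc(3)] a by (simp add: H_def)
    then have "g c = h c" using act_cancel'[OF hQ(2,1), of s] act_cancel'[OF hQ(3,1), of s] by metis
    moreover have "g i = h i" if "i \<in> crossing ` set ?w" "i \<noteq> c" for i
      using eq'[OF that(1)] that(2) by (simp add: H_def)
    ultimately show "z = z' \<and> (\<forall>i \<in> crossing ` set ?w. g i = h i)" using \<open>z = z'\<close> by blast
  qed (use col finite_word_colorings in auto)
qed

lemma rev_R3_strands:
  assumes "s \<in> {1, -1}" "ea \<in> {1, -1}" "eb \<in> {1, -1}" "ec \<in> {1, -1}"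
  shows "rev ` R3_strands s a b c ea eb ec = R3_strands (- s) a b c ea eb ec"
proof -
  have rev: "rev (directed k xs) = directed (- k) xs" if "k \<in> {1, -1}" for k and xs :: "passage list"
    using that by (auto simp: directed_def)
  have mult: "k * l \<in> {1, -1}" if "k \<in> {1, -1}" "l \<in> {1, -1}" for k l :: int
    using that by auto
  note m = mult[OF assms(1,2)] mult[OF assms(1,3)] mult[OF mult[OF mult[OF assms(1,2)] assms(3)] assms(4)]
  show ?thesis unfolding R3_strands_def image_insert image_empty m[THEN rev] by simp
qed

lemma card_word_colorings_R3:
  assumes gd: "gauss_diagram (u @ p @ v @ q @ x @ r @ y)"
    and gd': "gauss_diagram (u @ rev p @ v @ rev q @ x @ rev r @ y)"
    and s: "s \<in> {1, -1}"
    and pqr: "{p, q, r} = R3_strands s a b c ea eb ec"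
  shows "card (word_colorings Q act (u @ rev p @ v @ rev q @ x @ rev r @ y))
    = card (word_colorings Q act (u @ p @ v @ q @ x @ r @ y))"
proof (rule antisym)
  have "(\<Union>st \<in> {p, q, r}. set st) = (\<Union>st \<in> R3_strands s a b c ea eb ec. set st)" using pqr by simp
  then have "{Over a ea, Over b eb, Over c ec} \<subseteq> (\<Union>st \<in> {p, q, r}. set st)"
    by (auto simp: R3_strands_def directed_def)
  then have "{Over a ea, Over b eb, Over c ec} \<subseteq> set (u @ p @ v @ q @ x @ r @ y)" by auto
  note signs = this[unfolded insert_subset, THEN conjunct1, THEN gauss_diagram_sign[OF gd]]
    this[unfolded insert_subset, THEN conjunct2, THEN conjunct1, THEN gauss_diagram_sign[OF gd]]
    this[unfolded insert_subset, THEN conjunct2, THEN conjunct2, THEN conjunct1, THEN gauss_diagram_sign[OF gd]]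
  have "rev ` {p, q, r} = R3_strands (- s) a b c ea eb ec"
    unfolding pqr by (rule rev_R3_strands[OF s signs])
  then have "{rev p, rev q, rev r} = R3_strands (- s) a b c ea eb ec" by simp
  moreover have "- s \<in> {1, -1}" using s by auto
  ultimately show "card (word_colorings Q act (u @ rev p @ v @ rev q @ x @ rev r @ y))
      \<le> card (word_colorings Q act (u @ p @ v @ q @ x @ r @ y))"
    using card_word_colorings_R3_le[OF gd', of "- s" a b c ea eb ec] by simp
qed (rule card_word_colorings_R3_le[OF gd s pqr])

lemma word_colorings_F1:
  "word_colorings Q act (u @ [Over c e, Over d e'] @ v) = word_colorings Q act (u @ [Over d e', Over c e] @ v)"
  by (auto simp: word_colorings_def is_coloring_def fits_append insert_commute)

section \<open>The coloring number of a welded knot\<close>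

text \<open>Diagrams are unoriented, while reversing the direction turns colorings by a quandle into
  colorings by its dual. The maximum of the two counts does not depend on the direction.\<close>

definition coloring_number :: "passage list \<Rightarrow> nat" where
  "coloring_number w = max (card (word_colorings Q act w)) (card (word_colorings Q (dual act) w))"

lemma welded_move_coloring_number:
  assumes "welded_move w w'"
  shows "coloring_number w = coloring_number w'"
proof -
  interpret d: finite_quandle Q "dual act" by (rule finite_quandle_dual)
  have dd: "dual (dual act) = act" by (auto simp: dual_def)
  show ?thesis
    using assms
  proof cases
    case base_point
    then show ?thesis
      by (simp add: coloring_number_def card_word_colorings_rotate d.card_word_colorings_rotate)
  next
    case (names \<pi>)
    then show ?thesis
      by (simp add: coloring_number_def card_word_colorings_relabel d.card_word_colorings_relabel)
  next
    case reverse
    then show ?thesis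
      using word_colorings_rev[of w] d.word_colorings_rev[of w] dd
      by (simp add: coloring_number_def max.commute)
  next
    case (R1 u v p c e)
    then show ?thesis
      using card_word_colorings_R1[of u p v c e] d.card_word_colorings_R1[of u p v c e]
      by (simp add: coloring_number_def)
  next
    case (R2 u v x p q po c e d pu)
    then show ?thesis
      using card_word_colorings_R2[of u p v q x po c e d pu] d.card_word_colorings_R2[of u p v q x po c e d pu]
      by (simp add: coloring_number_def)
  next
    case (R3 u p v q x r y s a b c ea eb ec)
    then show ?thesis
      using card_word_colorings_R3[of u p v q x r y s a b c ea eb ec]
        d.card_word_colorings_R3[of u p v q x r y s a b c ea eb ec]
      by (simp add: coloring_number_def)
  next
    case (F1 u c e d e' v)
    then show ?thesis
      using word_colorings_F1[of u c e d e' v] d.word_colorings_F1[of u c e d e' v]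
      by (simp add: coloring_number_def)
  qed
qed

theorem welded_equiv_coloring_number:
  assumes "equivclp welded_move w w'"
  shows "coloring_number w = coloring_number w'"
  using assms
  by (induction rule: equivclp_induct) (auto dest: welded_move_coloring_number)

end

section \<open>Alexander quandles over a finite field\<close>

text \<open>The weights at the two signs are \<open>t\<close> and \<open>1/t\<close>. As a function \<open>\<omega>\<close> of the sign they make the
  dual quandle one of the same kind, with the weights exchanged.\<close>

locale alexander = field F for F (structure) +
  fixes \<omega> :: "int \<Rightarrow> 'a"
  assumes finite_F: "finite (carrier F)"
    and weight_closed: "\<omega> e \<in> carrier F"
    and weight_inverse: "\<omega> (- e) \<otimes> \<omega> e = \<one>"
begin

abbreviation act :: "int \<Rightarrow> 'a \<Rightarrow> 'a \<Rightarrow> 'a" where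
  "act e \<equiv> alexander_op F (\<omega> e)"

lemma alexander_op_closed:
  "s \<in> carrier F \<Longrightarrow> x \<in> carrier F \<Longrightarrow> y \<in> carrier F \<Longrightarrow> alexander_op F s x y \<in> carrier F"
  by (simp add: alexander_op_def)

lemma alexander_op_idem:
  assumes "s \<in> carrier F" "x \<in> carrier F"
  shows "alexander_op F s x x = x"
proof -
  have "s \<otimes> x \<oplus> (\<one> \<ominus> s) \<otimes> x = (s \<oplus> (\<one> \<ominus> s)) \<otimes> x" using assms by (simp add: l_distr)
  also have "s \<oplus> (\<one> \<ominus> s) = \<one>" using assms by algebra
  finally show ?thesis using assms by (simp add: alexander_op_def)
qed

lemma alexander_op_cancel:
  assumes "s \<in> carrier F" "r \<in> carrier F" "x \<in> carrier F" "y \<in> carrier F" "r \<otimes> s = \<one>"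
  shows "alexander_op F r (alexander_op F s x y) y = x"
proof -
  have "r \<otimes> (s \<otimes> x \<oplus> (\<one> \<ominus> s) \<otimes> y) \<oplus> (\<one> \<ominus> r) \<otimes> y = (r \<otimes> s) \<otimes> x \<oplus> (\<one> \<ominus> (r \<otimes> s)) \<otimes> y"
    using assms(1-4) by algebra
  also have "\<dots> = x" using assms(3,4) unfolding assms(5) by algebra
  finally show ?thesis by (simp add: alexander_op_def)
qed

lemma alexander_op_distrib:
  assumes "s \<in> carrier F" "r \<in> carrier F" "x \<in> carrier F" "y \<in> carrier F" "z \<in> carrier F"
  shows "alexander_op F r (alexander_op F s x z) y
    = alexander_op F s (alexander_op F r x y) (alexander_op F r z y)"
  unfolding alexander_op_def using assms by algebra

lemma alexander_op_diff:
  assumes "s \<in> carrier F" "x \<in> carrier F" "y \<in> carrier F" "x' \<in> carrier F" "y' \<in> carrier F"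
  shows "alexander_op F s (x \<ominus> x') (y \<ominus> y') = alexander_op F s x y \<ominus> alexander_op F s x' y'"
  unfolding alexander_op_def using assms by algebra

sublocale finite_quandle "carrier F" act
  by unfold_locales
    (auto simp: finite_F weight_closed weight_inverse alexander_op_closed alexander_op_idem
      alexander_op_cancel intro: alexander_op_distrib)

lemma alexander_dual: "alexander F (\<lambda>e. \<omega> (- e))"
  by unfold_locales (use finite_F weight_closed weight_inverse[of "- e" for e] in auto)

text \<open>Colorings depend linearly on the start color and the colors of the crossings.\<close>

lemma carry_fits_diff:
  assumes "x \<in> carrier F" "y \<in> carrier F"
    and "g \<in> crossing ` set w \<rightarrow> carrier F" "h \<in> crossing ` set w \<rightarrow> carrier F"
  shows "carry act (\<lambda>c. g c \<ominus> h c) (x \<ominus> y) w = carry act g x w \<ominus> carry act h y w \<and>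
    (fits act g x w \<longrightarrow> fits act h y w \<longrightarrow> fits act (\<lambda>c. g c \<ominus> h c) (x \<ominus> y) w)"
  using assms
proof (induction w arbitrary: x y)
  case (Cons p w)
  have "pass act g x p \<in> carrier F" "pass act h y p \<in> carrier F"
    using Cons.prems by (intro pass_closed; auto)+
  moreover have "pass act (\<lambda>c. g c \<ominus> h c) (x \<ominus> y) p = pass act g x p \<ominus> pass act h y p"
    using Cons.prems by (cases p) (auto simp: alexander_op_diff weight_closed)
  ultimately show ?case using Cons.IH[of "pass act g x p" "pass act h y p"] Cons.prems by auto
qed auto

lemma is_coloring_diff:
  assumes "is_coloring (carrier F) act w x g" "is_coloring (carrier F) act w y h"
  shows "is_coloring (carrier F) act w (x \<ominus> y) (\<lambda>c. g c \<ominus> h c)"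
  using assms carry_fits_diff[of x y g w h] by (auto simp: is_coloring_def Pi_iff)

text \<open>Exchanging the tail of \<open>c\<close> for a head has no effect on a color that equals \<open>g c\<close>, by
  idempotence.\<close>

lemma fits_twist_at:
  assumes "x \<in> carrier F" "g \<in> crossing ` set w \<rightarrow> carrier F"
    and "fits act g x w" and "\<And>e. Under c e \<notin> set w"
  shows "fits act g x (twist_at c w) \<and> carry act g x (twist_at c w) = carry act g x w"
  using assms
proof (induction w arbitrary: x)
  case (Cons p w)
  have q: "pass act g x p \<in> carrier F" using Cons.prems by (intro pass_closed) auto
  have "pass act g x (flip_at c p) = pass act g x p"
    using Cons.prems act_idem[of x] by (cases p) (auto simp: flip_at_def)
  moreover have "is_over (flip_at c p) \<Longrightarrow> g (crossing p) = x"
    using Cons.prems by (cases p) (auto simp: flip_at_def split: if_splits)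
  ultimately show ?case using Cons.IH[OF q] Cons.prems by (simp add: twist_at_flip)
qed (simp add: twist_at_flip)

lemma is_coloring_twist_at:
  assumes col: "is_coloring (carrier F) act (l @ Under c e # r) x g"
    and eq: "carry act g x l = g c"
    and no: "\<And>e. Under c e \<notin> set l \<union> set r"
  shows "is_coloring (carrier F) act (twist_at c (l @ Under c e # r)) x g"
proof -
  have tw: "twist_at c (l @ Under c e # r) = twist_at c l @ Over c e # twist_at c r"
    by (simp add: twist_at_flip)
  have X: "crossing ` set (twist_at c v) = crossing ` set v" for v
    by (simp add: twist_at_flip image_image)
  have gQ: "x \<in> carrier F" "g \<in> crossing ` set (l @ Under c e # r) \<rightarrow> carrier F"
    using col by (auto simp: is_coloring_def)
  then have gc: "g c \<in> carrier F" by auto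
  have "fits act g x l" using col by (simp add: is_coloring_def fits_append)
  then have l: "fits act g x (twist_at c l) \<and> carry act g x (twist_at c l) = carry act g x l"
    using gQ no by (intro fits_twist_at) auto
  have idem: "act e (g c) (g c) = g c" using gc by (rule act_idem)
  have "fits act g (g c) r" using col eq idem by (simp add: is_coloring_def fits_append)
  then have r: "fits act g (g c) (twist_at c r) \<and> carry act g (g c) (twist_at c r) = carry act g (g c) r"
    using gQ gc no by (intro fits_twist_at) auto
  show ?thesis
    using col l r eq idem gQ X[of "l @ Under c e # r"]
    by (simp add: is_coloring_def fits_append tw)
qed

lemma minus_eq_swap:
  assumes "a \<in> carrier F" "b \<in> carrier F" "a' \<in> carrier F" "b' \<in> carrier F"
    and "a \<ominus> b = a' \<ominus> b'"
  shows "a \<ominus> a' = b \<ominus> b'"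
proof -
  have "a \<ominus> a' = (a \<ominus> b) \<ominus> (a' \<ominus> b') \<oplus> (b \<ominus> b')" using assms(1-4) by algebra
  also have "\<dots> = b \<ominus> b'" unfolding assms(5) using assms(1-4) by algebra
  finally show ?thesis .
qed

text \<open>The colorings of \<open>w\<close> for which the two strands that meet at \<open>c\<close> have the same color are also
  colorings of the twisted diagram. They form the kernel of the linear functional \<open>\<delta>\<close>, the
  difference of these two colors, and each of the at most \<open>q\<close> nonempty fibres of \<open>\<delta>\<close> is a translate
  of the kernel.\<close>

lemma card_word_colorings_twist:
  assumes gd: "gauss_diagram w" and "twist w w'"
  shows "card (word_colorings (carrier F) act w)
    \<le> card (carrier F) * card (word_colorings (carrier F) act w')"
proof -
  obtain c where c: "c \<in> crossing ` set w" "w' = twist_at c w"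
    using assms(2) by (auto simp: twist_def)
  obtain e where e: "Over c e \<in> set w" "Under c e \<in> set w"
    using gauss_diagram_arrow[OF gd c(1)] .
  obtain l r where w: "w = l @ Under c e # r" using e(2) by (meson split_list)
  have no: "Under c e' \<notin> set l \<union> set r" for e'
  proof
    assume a: "Under c e' \<in> set l \<union> set r"
    then have "Under c e' = Over c e \<or> Under c e' = Under c e"
      using w by (intro gauss_diagram_letters[OF gd e(1)]) auto
    then show False using a gd w by (auto simp: gauss_diagram_def)
  qed
  define V where "V = word_colorings (carrier F) act w"
  define V' where "V' = word_colorings (carrier F) act w'"
  define \<delta> where "\<delta> = (\<lambda>(x, g). carry act g x l \<ominus> g c)"
  have fin: "finite V" "finite V'" unfolding V_def V'_def by (rule finite_word_colorings)+
  have X: "crossing ` set w' = crossing ` set w" by (simp add: c twist_at_flip image_image)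
  have closed: "carry act g x l \<in> carrier F" "g c \<in> carrier F" if "is_coloring (carrier F) act w x g" for x g
    using that c(1) w by (auto simp: is_coloring_def intro!: carry_closed)
  have fibre: "card {z \<in> V. \<delta> z = v} \<le> card V'" for v
  proof (cases "{z \<in> V. \<delta> z = v} = {}")
    case True
    then show ?thesis by (metis card.empty le0)
  next
    case False
    then obtain x0 g0 where 0: "is_coloring (carrier F) act w x0 g0" "\<delta> (x0, g0) = v"
      by (auto simp: V_def word_colorings_def)
    define \<Phi> where "\<Phi> = (\<lambda>(x, g). (x \<ominus> x0, restrict (\<lambda>i. g i \<ominus> g0 i) (crossing ` set w)))"
    show ?thesis
    proof (rule card_inj_on_le[OF _ _ fin(2)])
      show "\<Phi> ` {z \<in> V. \<delta> z = v} \<subseteq> V'"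
      proof (rule image_subsetI)
        fix z assume "z \<in> {z \<in> V. \<delta> z = v}"
        then obtain x g where z: "z = (x, g)" and 1: "(x, g) \<in> V" and v: "v = \<delta> (x, g)"
          by (cases z) auto
        then have col: "is_coloring (carrier F) act w x g" by (simp add: V_def word_colorings_def)
        have "carry act (\<lambda>i. g i \<ominus> g0 i) (x \<ominus> x0) l = carry act g x l \<ominus> carry act g0 x0 l"
          using carry_fits_diff[of x x0 g l g0] col 0 w by (auto simp: is_coloring_def)
        also have "\<dots> = g c \<ominus> g0 c"
        proof -
          have eq: "carry act g x l \<ominus> g c = carry act g0 x0 l \<ominus> g0 c"
            using v 0(2) by (simp add: \<delta>_def)
          show ?thesis by (rule minus_eq_swap[OF closed[OF col] closed[OF 0(1)] eq])
        qed
        finally have "is_coloring (carrier F) act w' (x \<ominus> x0) (\<lambda>i. g i \<ominus> g0 i)"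
          using is_coloring_twist_at[OF is_coloring_diff[OF col 0(1), unfolded w] _ no]
          unfolding c(2) w by simp
        then show "\<Phi> z \<in> V'"
          unfolding z using is_coloring_restrict[of "carrier F" act w' "x \<ominus> x0" "\<lambda>i. g i \<ominus> g0 i"]
          by (simp add: \<Phi>_def V'_def X)
      qed
      show "inj_on \<Phi> {z \<in> V. \<delta> z = v}"
      proof (rule inj_onI)
        fix z z' assume "z \<in> {z \<in> V. \<delta> z = v}" "z' \<in> {z \<in> V. \<delta> z = v}" "\<Phi> z = \<Phi> z'"
        then obtain x g y h where z: "z = (x, g)" "z' = (y, h)"
          and 1: "(x, g) \<in> V" "(y, h) \<in> V" and eq: "\<Phi> (x, g) = \<Phi> (y, h)"
          by (cases z; cases z') auto
        have cols: "is_coloring (carrier F) act w x g" "is_coloring (carrier F) act w y h"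
          and ext: "g \<in> extensional (crossing ` set w)" "h \<in> extensional (crossing ` set w)"
          using 1 by (auto simp: V_def word_colorings_def)
        have cancel: "a = b" if "a \<ominus> k = b \<ominus> k" "a \<in> carrier F" "b \<in> carrier F" "k \<in> carrier F" for a b k
          using that by (simp add: a_minus_def)
        have "x \<ominus> x0 = y \<ominus> x0"
          and R: "restrict (\<lambda>i. g i \<ominus> g0 i) (crossing ` set w) = restrict (\<lambda>i. h i \<ominus> g0 i) (crossing ` set w)"
          using eq by (auto simp: \<Phi>_def)
        have d: "g i \<ominus> g0 i = h i \<ominus> g0 i" if "i \<in> crossing ` set w" for i
          using fun_cong[OF R, of i] that by simp
        have mem: "x \<in> carrier F" "y \<in> carrier F" "x0 \<in> carrier F"
          "g \<in> crossing ` set w \<rightarrow> carrier F" "h \<in> crossing ` set w \<rightarrow> carrier F" "g0 \<in> crossing ` set w \<rightarrow> carrier F"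
          using cols 0 unfolding is_coloring_def by blast+
        have "x = y" by (rule cancel[OF \<open>x \<ominus> x0 = y \<ominus> x0\<close> mem(1,2,3)])
        moreover have "g = h"
          by (rule extensionalityI[OF ext])
             (rule cancel[OF d funcset_mem[OF mem(4)] funcset_mem[OF mem(5)] funcset_mem[OF mem(6)]])
        ultimately show "z = z'" unfolding z by simp
      qed
    qed
  qed
  have "V = (\<Union>v \<in> carrier F. {z \<in> V. \<delta> z = v})"
    using closed by (auto simp: V_def word_colorings_def \<delta>_def)
  then have "card V \<le> (\<Sum>v \<in> carrier F. card {z \<in> V. \<delta> z = v})"
    using card_UN_le[OF finite_F, of "\<lambda>v. {z \<in> V. \<delta> z = v}"] by simp
  also have "\<dots> \<le> (\<Sum>v \<in> carrier F. card V')" by (rule sum_mono) (rule fibre)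
  finally show ?thesis by (simp add: V_def V'_def)
qed

lemma coloring_number_twist:
  assumes "gauss_diagram w" and "twist w w'"
  shows "coloring_number w \<le> card (carrier F) * coloring_number w'"
proof -
  interpret d: alexander F "\<lambda>e. \<omega> (- e)" by (rule alexander_dual)
  have "dual act = d.act" by (simp add: dual_def fun_eq_iff)
  then have "card (word_colorings (carrier F) (dual act) w)
    \<le> card (carrier F) * card (word_colorings (carrier F) (dual act) w')"
    using d.card_word_colorings_twist[OF assms] by simp
  then show ?thesis
    using card_word_colorings_twist[OF assms] unfolding coloring_number_def nat_mult_max_right
    by linarith
qed

lemma coloring_number_twists:
  assumes "gauss_diagram w" and "(twist ^^ n) w w'"
  shows "coloring_number w \<le> card (carrier F) ^ n * coloring_number w'"
  using assms(2)
proof (induction n arbitrary: w')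
  case (Suc n)
  then obtain v where v: "(twist ^^ n) w v" "twist v w'" by auto
  have "coloring_number w \<le> card (carrier F) ^ n * coloring_number v" by (rule Suc.IH[OF v(1)])
  also have "\<dots> \<le> card (carrier F) ^ n * (card (carrier F) * coloring_number w')"
    using coloring_number_twist[OF gauss_diagram_twists[OF v(1) assms(1)] v(2)] by simp
  finally show ?case by (simp add: ac_simps)
qed simp

lemma coloring_number_Nil: "coloring_number [] = card (carrier F)"
proof -
  have "word_colorings (carrier F) a [] = (\<lambda>x. (x, \<lambda>_. undefined)) ` carrier F" for a
    by (auto simp: word_colorings_def is_coloring_def extensional_def)
  then show ?thesis by (simp add: coloring_number_def card_image inj_on_def)
qed

lemma coloring_number_ut_diagram:
  assumes "gauss_diagram w"
  shows "coloring_number w \<le> card (carrier F) ^ (ut_diagram w + 1)"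
proof -
  obtain w' where w': "w' \<in> trivial_knot" "(twist ^^ ut_diagram w) w w'"
    using ut_diagram_attained[OF assms] by blast
  then have "coloring_number w' = card (carrier F)"
    using welded_equiv_coloring_number[of "[]" w'] coloring_number_Nil
    by (simp add: trivial_knot_def welded_equiv_def)
  then show ?thesis using coloring_number_twists[OF assms w'(2)] by (simp add: ac_simps)
qed

end

text \<open>Different coefficients with respect to a basis give different vectors.\<close>

lemma (in vectorspace) card_power_dim_le:
  assumes fin: "finite (carrier V)"
  shows "card (carrier K) ^ dim \<le> card (carrier V)"
proof -
  have "span (carrier V) = carrier V"
    using in_own_span[of "carrier V"] span_is_subset2[of "carrier V"] by auto
  then have fd: fin_dim using fin unfolding fin_dim_def by blast
  then obtain \<beta> where b: "finite \<beta>" "basis \<beta>" using finite_basis_exists by blast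
  then have dim: "dim = card \<beta>" by (rule dim_basis)
  have bV: "\<beta> \<subseteq> carrier V" and li: "lin_indpt \<beta>" using b(2) by (auto simp: basis_def)
  have inj: "inj_on (\<lambda>a. lincomb a \<beta>) (\<beta> \<rightarrow>\<^sub>E carrier K)"
  proof (rule inj_onI)
    fix a a' assume a: "a \<in> \<beta> \<rightarrow>\<^sub>E carrier K" "a' \<in> \<beta> \<rightarrow>\<^sub>E carrier K"
      and eq: "lincomb a \<beta> = lincomb a' \<beta>"
    then have m: "a \<in> \<beta> \<rightarrow> carrier K" "a' \<in> \<beta> \<rightarrow> carrier K" by auto
    have cl: "lincomb a' \<beta> \<in> carrier V" using bV m by (intro lincomb_closed) auto
    have z: "lincomb (\<lambda>v. a v \<ominus>\<^bsub>K\<^esub> a' v) \<beta> = \<zero>\<^bsub>V\<^esub>"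
      using lincomb_diff[OF b(1) bV m] eq cl by (simp add: a_minus_def M.r_neg)
    have "a v = a' v" if v: "v \<in> \<beta>" for v
    proof -
      have "a v \<ominus>\<^bsub>K\<^esub> a' v = \<zero>\<^bsub>K\<^esub>"
        using lin_dep_crit[OF b(1) subset_refl _ v _ z] li m by (auto simp: Pi_iff)
      then show ?thesis using m v by (auto simp: Pi_iff R.r_right_minus_eq)
    qed
    then show "a = a'" using a by (intro PiE_ext[of a \<beta> "\<lambda>_. carrier K"]) auto
  qed
  have "card (carrier K) ^ card \<beta> = card (\<beta> \<rightarrow>\<^sub>E carrier K)" using b(1) by (simp add: card_PiE)
  also have "\<dots> \<le> card (carrier V)"
    by (rule card_inj_on_le[OF inj _ fin]) (use bV in \<open>auto intro!: lincomb_closed\<close>)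
  finally show ?thesis by (simp add: dim)
qed

section \<open>The space of arc colorings\<close>

text \<open>The coloring conditions as a set of triples of arcs, so that the vector space axioms need
  nothing of the diagram.\<close>

definition arc_relations :: "passage list \<Rightarrow> (nat set \<times> nat set \<times> nat set) set" where
  "arc_relations w =
     {(arc_of w (if e = 1 then in_edge w i else i), arc_of w j,
       arc_of w (if e = 1 then i else in_edge w i)) | i j c e.
      i < length w \<and> j < length w \<and> w ! i = Under c e \<and> w ! j = Over c e}"

lemma colorings_arc_relations:
  "colorings F t w = {C \<in> arcs w \<rightarrow>\<^sub>E carrier F.
     \<forall>(\<alpha>, \<beta>, \<gamma>) \<in> arc_relations w. C \<gamma> = alexander_op F t (C \<alpha>) (C \<beta>)}"
  unfolding colorings_def arc_relations_def Let_def by fast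

lemma arc_in_arcs: "i < length w \<Longrightarrow> arc_of w i \<in> arcs w"
  by (auto simp: arcs_def edges_def)

lemma in_edge_less: "i < length w \<Longrightarrow> in_edge w i < length w"
  unfolding in_edge_def by (rule mod_less_divisor) auto

lemma arc_relations_arcs: "arc_relations w \<subseteq> arcs w \<times> arcs w \<times> arcs w"
  by (auto simp: arc_relations_def arc_in_arcs in_edge_less)

lemma finite_arcs: "finite (arcs w)"
  by (simp add: arcs_def edges_def)

lemma (in field) alexander_op_add:
  assumes "s \<in> carrier R" "x \<in> carrier R" "y \<in> carrier R" "x' \<in> carrier R" "y' \<in> carrier R"
  shows "alexander_op R s (x \<oplus> x') (y \<oplus> y') = alexander_op R s x y \<oplus> alexander_op R s x' y'"
  unfolding alexander_op_def using assms by algebra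

lemma (in field) alexander_op_smult:
  assumes "s \<in> carrier R" "x \<in> carrier R" "y \<in> carrier R" "k \<in> carrier R"
  shows "alexander_op R s (k \<otimes> x) (k \<otimes> y) = k \<otimes> alexander_op R s x y"
  unfolding alexander_op_def using assms by algebra

lemma (in field) vectorspace_Col:
  assumes t: "t \<in> carrier R"
  shows "vectorspace R (Col R t w)"
proof -
  let ?V = "Col R t w"
  have carrier: "carrier ?V = colorings R t w" by (simp add: Col_def)
  have val: "C a \<in> carrier R" if "C \<in> colorings R t w" "a \<in> arcs w" for C a
    using that by (auto simp: colorings_arc_relations)
  have out: "C a = undefined" if "C \<in> colorings R t w" "a \<notin> arcs w" for C a
    using that by (auto simp: colorings_arc_relations PiE_def extensional_def)
  have coloringI: "(\<lambda>a \<in> arcs w. f a) \<in> colorings R t w"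
    if "\<And>a. a \<in> arcs w \<Longrightarrow> f a \<in> carrier R"
      and "\<And>\<alpha> \<beta> \<gamma>. (\<alpha>, \<beta>, \<gamma>) \<in> arc_relations w \<Longrightarrow> \<alpha> \<in> arcs w \<Longrightarrow> \<beta> \<in> arcs w \<Longrightarrow> \<gamma> \<in> arcs w
        \<Longrightarrow> f \<gamma> = alexander_op R t (f \<alpha>) (f \<beta>)" for f
    using that arc_relations_arcs[of w] unfolding colorings_arc_relations by fastforce
  have rel: "C \<gamma> = alexander_op R t (C \<alpha>) (C \<beta>)"
    if "C \<in> colorings R t w" "(\<alpha>, \<beta>, \<gamma>) \<in> arc_relations w" for C \<alpha> \<beta> \<gamma>
    using that by (auto simp: colorings_arc_relations)
  have add: "C \<oplus>\<^bsub>?V\<^esub> C' = (\<lambda>a \<in> arcs w. C a \<oplus> C' a)" for C C' by (simp add: Col_def)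
  have smult: "k \<odot>\<^bsub>?V\<^esub> C = (\<lambda>a \<in> arcs w. k \<otimes> C a)" for k C by (simp add: Col_def)
  have zero: "\<zero>\<^bsub>?V\<^esub> = (\<lambda>a \<in> arcs w. \<zero>)" by (simp add: Col_def)
  have smult_closed: "k \<odot>\<^bsub>?V\<^esub> C \<in> colorings R t w" if "k \<in> carrier R" "C \<in> colorings R t w" for k C
    unfolding smult using that t by (intro coloringI) (simp_all add: val rel alexander_op_smult)
  have add_closed: "C \<oplus>\<^bsub>?V\<^esub> C' \<in> colorings R t w"
    if "C \<in> colorings R t w" "C' \<in> colorings R t w" for C C'
    unfolding add using that t
    by (intro coloringI) (simp_all add: val rel[of C] rel[of C'] alexander_op_add)
  have zero_closed: "\<zero>\<^bsub>?V\<^esub> \<in> colorings R t w"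
    unfolding zero using t by (intro coloringI) (simp_all add: alexander_op_def)
  have ext: "C = C'" if "C \<in> colorings R t w" "C' \<in> colorings R t w"
    "\<And>a. a \<in> arcs w \<Longrightarrow> C a = C' a" for C C'
    using that out by (metis ext)
  note closed = add_closed smult_closed zero_closed
  have "abelian_group ?V"
  proof (rule abelian_groupI; unfold carrier)
    fix C assume C: "C \<in> colorings R t w"
    show "\<exists>C' \<in> colorings R t w. C' \<oplus>\<^bsub>?V\<^esub> C = \<zero>\<^bsub>?V\<^esub>"
    proof (rule bexI[of _ "(\<ominus> \<one>) \<odot>\<^bsub>?V\<^esub> C"])
      show "((\<ominus> \<one>) \<odot>\<^bsub>?V\<^esub> C) \<oplus>\<^bsub>?V\<^esub> C = \<zero>\<^bsub>?V\<^esub>"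
        using C by (intro ext closed) (simp_all add: add smult zero val l_minus l_neg)
    qed (use C closed in simp)
  next
    fix C D E assume "C \<in> colorings R t w" "D \<in> colorings R t w" "E \<in> colorings R t w"
    then show "(C \<oplus>\<^bsub>?V\<^esub> D) \<oplus>\<^bsub>?V\<^esub> E = C \<oplus>\<^bsub>?V\<^esub> (D \<oplus>\<^bsub>?V\<^esub> E)"
      by (intro ext closed) (simp_all add: add val a_assoc)
  next
    fix C D assume "C \<in> colorings R t w" "D \<in> colorings R t w"
    then show "C \<oplus>\<^bsub>?V\<^esub> D = D \<oplus>\<^bsub>?V\<^esub> C"
      by (intro ext closed) (simp_all add: add val a_comm)
  next
    fix C assume "C \<in> colorings R t w"
    then show "\<zero>\<^bsub>?V\<^esub> \<oplus>\<^bsub>?V\<^esub> C = C"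
      by (intro ext closed) (simp_all add: add zero val)
  qed (use closed in simp_all)
  then have "module R ?V"
  proof (rule moduleI[OF is_cring]; unfold carrier)
    fix k l C assume kl: "k \<in> carrier R" "l \<in> carrier R" and C: "C \<in> colorings R t w"
    then show "(k \<oplus> l) \<odot>\<^bsub>?V\<^esub> C = (k \<odot>\<^bsub>?V\<^esub> C) \<oplus>\<^bsub>?V\<^esub> (l \<odot>\<^bsub>?V\<^esub> C)"
      by (intro ext closed) (simp_all add: add smult val l_distr)
    show "(k \<otimes> l) \<odot>\<^bsub>?V\<^esub> C = k \<odot>\<^bsub>?V\<^esub> (l \<odot>\<^bsub>?V\<^esub> C)"
      using kl C by (intro ext closed) (simp_all add: smult val m_assoc)
  next
    fix k C D assume "k \<in> carrier R" "C \<in> colorings R t w" "D \<in> colorings R t w"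
    then show "k \<odot>\<^bsub>?V\<^esub> (C \<oplus>\<^bsub>?V\<^esub> D) = (k \<odot>\<^bsub>?V\<^esub> C) \<oplus>\<^bsub>?V\<^esub> (k \<odot>\<^bsub>?V\<^esub> D)"
      by (intro ext closed) (simp_all add: add smult val r_distr)
  next
    fix C assume "C \<in> colorings R t w"
    then show "\<one> \<odot>\<^bsub>?V\<^esub> C = C"
      by (intro ext closed) (simp_all add: smult val)
  qed (use closed in simp_all)
  then show ?thesis by (intro vectorspace.intro field_axioms)
qed

lemma fits_nth:
  "fits a g x w \<longleftrightarrow> (\<forall>i < length w. is_over (w ! i) \<longrightarrow> g (crossing (w ! i)) = carry a g x (take i w))"
proof (induction w arbitrary: x)
  case (Cons p w)
  show ?case unfolding fits.simps Cons.IH by (auto simp: All_less_Suc2)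
qed simp

lemma arc_of_in_edge:
  assumes "i < length w" "is_over (w ! i)"
  shows "arc_of w (in_edge w i) = arc_of w i"
proof -
  let ?r = "\<lambda>k l. \<exists>i < length w. is_over (w ! i) \<and> k = in_edge w i \<and> l = i"
  have "?r (in_edge w i) i" using assms by blast
  then have "equivclp ?r (in_edge w i) i" by (rule r_into_equivclp)
  then have "equivclp ?r (in_edge w i) l \<longleftrightarrow> equivclp ?r i l" for l
    by (blast intro: equivclp_trans equivclp_sym)
  then show ?thesis unfolding arc_of_def by (rule Collect_cong)
qed

lemma in_edge_Suc: "Suc i < length w \<Longrightarrow> in_edge w (Suc i) = i"
  by (simp add: in_edge_def)

lemma in_edge_0: "w \<noteq> [] \<Longrightarrow> in_edge w 0 = length w - 1"
  by (simp add: in_edge_def)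

context alexander
begin

text \<open>The base point lies on the last edge; for the empty word \<open>length w - 1\<close> is \<open>0\<close>, the number of its
  only edge.\<close>

definition word_of_arc_coloring :: "passage list \<Rightarrow> (nat set \<Rightarrow> 'a) \<Rightarrow> 'a \<times> (nat \<Rightarrow> 'a)" where
  "word_of_arc_coloring w C =
     (C (arc_of w (length w - 1)),
      \<lambda>c \<in> crossing ` set w. C (arc_of w (SOME j. j < length w \<and> crossing (w ! j) = c \<and> is_over (w ! j))))"

text \<open>The color carried through the first \<open>i + 1\<close> letters is that of the arc through edge \<open>i\<close>: at a tail
  the arc goes on, and at a head the coloring condition is the rule by which the color changes.
  For a negative sign the condition expresses the incoming color by the outgoing one and has to be
  inverted. In particular the coloring of the arcs can be recovered from \<open>(x, g)\<close>.\<close>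

lemma word_of_arc_coloring:
  assumes gd: "gauss_diagram w" and C: "C \<in> colorings F (\<omega> 1) w"
    and xg: "word_of_arc_coloring w C = (x, g)"
  shows "is_coloring (carrier F) act w x g"
    and "i < length w \<Longrightarrow> carry act g x (take (Suc i) w) = C (arc_of w i)"
proof -
  have CF: "C a \<in> carrier F" if "a \<in> arcs w" for a
    using C that by (auto simp: colorings_arc_relations)
  have x: "x = C (arc_of w (length w - 1))" using xg by (simp add: word_of_arc_coloring_def)
  have g: "g c = C (arc_of w j)" if "j < length w" "w ! j = Over c e" for c e j
  proof -
    let ?P = "\<lambda>j. j < length w \<and> crossing (w ! j) = c \<and> is_over (w ! j)"
    have "?P j" using that by simp
    then have P: "?P (Eps ?P)" by (rule someI[of ?P])
    then have "w ! Eps ?P = Over c e"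
      using gauss_diagram_letters[OF gd, of c e "w ! Eps ?P"] that nth_mem[of j w] nth_mem[of "Eps ?P" w]
      by auto
    moreover have "distinct w" using gd by (simp add: gauss_diagram_def)
    ultimately have "Eps ?P = j"
      using P that nth_eq_iff_index_eq[of w "Eps ?P" j] by simp
    moreover have "c \<in> crossing ` set w" using that nth_mem[of j w] by force
    ultimately show ?thesis using xg by (auto simp: word_of_arc_coloring_def)
  qed
  have over: "\<exists>j < length w. w ! j = Over c e" if "i < length w" "w ! i = Under c e" for i c e
  proof -
    have "Over c e \<in> set w" using that nth_mem[of i w] gd by (simp add: gauss_diagram_def)
    then show ?thesis by (auto simp: in_set_conv_nth)
  qed
  have step: "pass act g (C (arc_of w (in_edge w i))) (w ! i) = C (arc_of w i)" if i: "i < length w" for i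
  proof (cases "w ! i")
    case (Over c e)
    then show ?thesis using arc_of_in_edge[OF i] by simp
  next
    case (Under c e)
    then obtain j where j: "j < length w" "w ! j = Over c e" using over i by blast
    have e: "e \<in> {1, -1}" using gauss_diagram_sign[OF gd, of c e] nth_mem[OF j(1)] j(2) by simp
    have cl: "C (arc_of w i) \<in> carrier F" "C (arc_of w (in_edge w i)) \<in> carrier F" "C (arc_of w j) \<in> carrier F"
      using i j by (auto intro!: CF arc_in_arcs in_edge_less)
    have "(arc_of w (if e = 1 then in_edge w i else i), arc_of w j,
       arc_of w (if e = 1 then i else in_edge w i)) \<in> arc_relations w"
      unfolding arc_relations_def using i j Under by blast
    then have r: "C (arc_of w (if e = 1 then i else in_edge w i))
      = act 1 (C (arc_of w (if e = 1 then in_edge w i else i))) (C (arc_of w j))"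
      using C by (auto simp: colorings_arc_relations)
    have "act e (C (arc_of w (in_edge w i))) (C (arc_of w j)) = C (arc_of w i)"
    proof (cases "e = 1")
      case True
      then show ?thesis using r by simp
    next
      case False
      then have "e = - 1" using e by simp
      then show ?thesis using r act_cancel[OF cl(1,3), of 1] by simp
    qed
    then show ?thesis using g[OF j] Under by simp
  qed
  have car: "carry act g x (take i w) = C (arc_of w (in_edge w i))" if "i < length w" for i
    using that
  proof (induction i)
    case 0
    then have "w \<noteq> []" by auto
    then show ?case by (simp add: in_edge_0 x)
  next
    case (Suc i)
    then show ?case using step[of i] by (simp add: take_Suc_conv_app_nth in_edge_Suc)
  qed
  then show *: "i < length w \<Longrightarrow> carry act g x (take (Suc i) w) = C (arc_of w i)" for i
    using step[of i] by (simp add: take_Suc_conv_app_nth)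
  have "fits act g x w" unfolding fits_nth
  proof (intro allI impI)
    fix i assume i: "i < length w" "is_over (w ! i)"
    then obtain c e where "w ! i = Over c e" by (cases "w ! i") auto
    then show "g (crossing (w ! i)) = carry act g x (take i w)"
      using i car arc_of_in_edge g by simp
  qed
  moreover have "carry act g x w = x"
  proof (cases "w = []")
    case False
    then show ?thesis using *[of "length w - 1"] x by simp
  qed simp
  moreover have "x \<in> carrier F"
  proof -
    have "arc_of w (length w - 1) \<in> arcs w" by (auto simp: arcs_def edges_def)
    then show ?thesis unfolding x by (rule CF)
  qed
  moreover have "g \<in> crossing ` set w \<rightarrow> carrier F"
  proof (rule funcsetI)
    fix c assume "c \<in> crossing ` set w"
    then obtain e where "Over c e \<in> set w" by (rule gauss_diagram_arrow[OF gd])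
    then obtain j where "j < length w" "w ! j = Over c e" by (auto simp: in_set_conv_nth)
    then show "g c \<in> carrier F" using g CF arc_in_arcs by simp
  qed
  ultimately show "is_coloring (carrier F) act w x g" by (simp add: is_coloring_def)
qed

lemma card_colorings_le:
  assumes gd: "gauss_diagram w"
  shows "card (colorings F (\<omega> 1) w) \<le> coloring_number w"
proof -
  have "card (colorings F (\<omega> 1) w) \<le> card (word_colorings (carrier F) act w)"
  proof (rule card_inj_on_le[OF _ _ finite_word_colorings])
    show "word_of_arc_coloring w ` colorings F (\<omega> 1) w \<subseteq> word_colorings (carrier F) act w"
      using word_of_arc_coloring(1)[OF gd]
      by (auto simp: word_colorings_def) (auto simp: word_of_arc_coloring_def)
    show "inj_on (word_of_arc_coloring w) (colorings F (\<omega> 1) w)"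
    proof (rule inj_onI)
      fix C C' assume C: "C \<in> colorings F (\<omega> 1) w" "C' \<in> colorings F (\<omega> 1) w"
        and eq: "word_of_arc_coloring w C = word_of_arc_coloring w C'"
      obtain x g where xg: "word_of_arc_coloring w C = (x, g)" by fastforce
      have "C (arc_of w i) = C' (arc_of w i)" if "i \<in> edges w" for i
      proof (cases "w = []")
        case True
        then show ?thesis using eq that by (simp add: word_of_arc_coloring_def edges_def)
      next
        case False
        then have "i < length w" using that by (cases w) (auto simp: edges_def)
        then show ?thesis
          using word_of_arc_coloring(2)[OF gd C(1) xg] word_of_arc_coloring(2)[OF gd C(2)] xg eq by metis
      qed
      then have "C a = C' a" if "a \<in> arcs w" for a using that by (auto simp: arcs_def)
      then show "C = C'"
        using C PiE_ext[of C "arcs w" "\<lambda>_. carrier F" C'] by (auto simp: colorings_arc_relations)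
    qed
  qed
  then show ?thesis by (simp add: coloring_number_def)
qed

lemma card_power_dim_Col_le:
  "card (carrier F) ^ vectorspace.dim F (Col F (\<omega> 1) w) \<le> card (colorings F (\<omega> 1) w)"
proof -
  interpret V: vectorspace F "Col F (\<omega> 1) w" using vectorspace_Col[OF weight_closed] .
  have "finite (colorings F (\<omega> 1) w)"
    unfolding colorings_def
    by (rule finite_subset[OF _ finite_PiE[OF finite_arcs, of _ "\<lambda>_. carrier F"]]) (use finite_F in auto)
  then show ?thesis using V.card_power_dim_le by (simp add: Col_def)
qed

text \<open>The dimension is at most the logarithm, to base \<open>card (carrier F)\<close>, of the coloring number, and this
  number agrees for \<open>D\<close> and the diagram of \<open>K\<close> that attains the unknotting twist number.\<close>

theorem dim_Col_le_ut_knot: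
  assumes "K \<in> welded_knots" and "D \<in> K"
  shows "vectorspace.dim F (Col F (\<omega> 1) D) \<le> ut_knot K + 1"
proof -
  obtain w where w: "w \<in> K" "ut_knot K = ut_diagram w" using ut_knot_attained[OF assms(2)] by blast
  note D = welded_knot_members[OF assms w(1)]
  have "card (carrier F) ^ vectorspace.dim F (Col F (\<omega> 1) D) \<le> coloring_number D"
    using card_power_dim_Col_le card_colorings_le[OF D(1)] by (rule le_trans)
  also have "\<dots> = coloring_number w" by (rule welded_equiv_coloring_number[OF D(3)])
  also have "\<dots> \<le> card (carrier F) ^ (ut_knot K + 1)"
    unfolding w(2) by (rule coloring_number_ut_diagram[OF D(2)])
  finally have le: "card (carrier F) ^ vectorspace.dim F (Col F (\<omega> 1) D) \<le> card (carrier F) ^ (ut_knot K + 1)" .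
  have "card {\<zero>, \<one>} \<le> card (carrier F)" using finite_F by (intro card_mono) auto
  then have "1 < card (carrier F)" by simp
  then show ?thesis using le power_le_imp_le_exp by blast
qed

end

lemma dim_Col_le_ut_knot_finite_field:
  assumes "field F" and "finite (carrier F)" and t: "t \<in> Units F"
    and "K \<in> welded_knots" and "D \<in> K"
  shows "vectorspace.dim F (Col F t D) \<le> ut_knot K + 1"
proof -
  interpret F: field F by fact
  define \<omega> where "\<omega> e = (if e = 1 then t else if e = - 1 then inv\<^bsub>F\<^esub> t else \<one>\<^bsub>F\<^esub>)" for e :: int
  interpret alexander F \<omega>
  proof unfold_locales
    show "\<omega> (- e) \<otimes>\<^bsub>F\<^esub> \<omega> e = \<one>\<^bsub>F\<^esub>" for e
      using t F.Units_l_inv F.Units_r_inv by (cases "e = 1"; cases "e = - 1") (auto simp: \<omega>_def)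
  qed (use assms in \<open>auto simp: \<omega>_def\<close>)
  show ?thesis using dim_Col_le_ut_knot[OF assms(4,5)] by (simp add: \<omega>_def)
qed

section \<open>Laurent polynomials over a field\<close>

definition laurent_support :: "('a, 'm) ring_scheme \<Rightarrow> (int \<Rightarrow> 'a) \<Rightarrow> int set" where
  "laurent_support R g = {i. g i \<noteq> \<zero>\<^bsub>R\<^esub>}"

text \<open>The Laurent polynomial \<open>c t\<^sup>n\<close>.\<close>

definition term_at :: "('a, 'm) ring_scheme \<Rightarrow> 'a \<Rightarrow> int \<Rightarrow> int \<Rightarrow> 'a" where
  "term_at R c n = (\<lambda>k. if k = n then c else \<zero>\<^bsub>R\<^esub>)"

context field
begin

abbreviation "L \<equiv> laurent_ring R"
abbreviation "supp \<equiv> laurent_support R"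

lemma laurent_carrier: "g \<in> carrier L \<longleftrightarrow> (\<forall>i. g i \<in> carrier R) \<and> finite (supp g)"
  by (auto simp: laurent_ring_def laurent_support_def)

lemma laurent_coeff: "g \<in> carrier L \<Longrightarrow> g i \<in> carrier R"
  by (simp add: laurent_carrier)

lemma laurent_add: "(g \<oplus>\<^bsub>L\<^esub> h) i = g i \<oplus> h i"
  by (simp add: laurent_ring_def)

lemma laurent_zero: "\<zero>\<^bsub>L\<^esub> = (\<lambda>_. \<zero>)"
  by (simp add: laurent_ring_def)

lemma laurent_one: "\<one>\<^bsub>L\<^esub> = term_at R \<one> 0"
  by (simp add: laurent_ring_def term_at_def)

text \<open>The product as a sum over any finite set that contains the support, which frees the following
  computations from the supports of sums and products.\<close>

lemma laurent_mult:
  assumes g: "g \<in> carrier L" and h: "h \<in> carrier L" and I: "finite I" "supp g \<subseteq> I"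
  shows "(g \<otimes>\<^bsub>L\<^esub> h) k = (\<Oplus>i \<in> I. g i \<otimes> h (k - i))"
proof -
  have "(\<Oplus>i \<in> supp g. g i \<otimes> h (k - i)) = (\<Oplus>i \<in> I. g i \<otimes> h (k - i))"
    using laurent_coeff[OF g] laurent_coeff[OF h] I
    by (intro add.finprod_mono_neutral_cong_left) (auto simp: laurent_support_def)
  then show ?thesis by (simp add: laurent_ring_def laurent_support_def)
qed

lemma support_mult:
  assumes g: "g \<in> carrier L" and h: "h \<in> carrier L"
  shows "supp (g \<otimes>\<^bsub>L\<^esub> h) \<subseteq> (\<lambda>(i, m). i + m) ` (supp g \<times> supp h)"
proof
  fix k assume k: "k \<in> supp (g \<otimes>\<^bsub>L\<^esub> h)"
  show "k \<in> (\<lambda>(i, m). i + m) ` (supp g \<times> supp h)"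
  proof (rule ccontr)
    assume n: "k \<notin> (\<lambda>(i, m). i + m) ` (supp g \<times> supp h)"
    have "g i \<otimes> h (k - i) = \<zero>" for i
    proof -
      have "i \<notin> supp g \<or> k - i \<notin> supp h"
        using n by (auto simp: image_iff) (metis add.commute diff_add_cancel)
      then show ?thesis using laurent_coeff[OF g] laurent_coeff[OF h] by (auto simp: laurent_support_def)
    qed
    then have "(g \<otimes>\<^bsub>L\<^esub> h) k = \<zero>"
      using laurent_mult[OF g h _ subset_refl] g by (simp add: laurent_carrier)
    then show False using k by (simp add: laurent_support_def)
  qed
qed

lemma laurent_mult_closed:
  assumes g: "g \<in> carrier L" and h: "h \<in> carrier L"
  shows "g \<otimes>\<^bsub>L\<^esub> h \<in> carrier L"
proof -
  have fin: "finite (supp g)" "finite (supp h)" using g h by (auto simp: laurent_carrier)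
  then have "finite (supp (g \<otimes>\<^bsub>L\<^esub> h))"
    by (intro finite_subset[OF support_mult[OF g h]]) auto
  moreover have "(g \<otimes>\<^bsub>L\<^esub> h) k \<in> carrier R" for k
    unfolding laurent_mult[OF g h fin(1) subset_refl]
    using laurent_coeff[OF g] laurent_coeff[OF h] by (intro finsum_closed) auto
  ultimately show ?thesis by (simp add: laurent_carrier)
qed

lemma laurent_add_closed:
  assumes "g \<in> carrier L" "h \<in> carrier L"
  shows "g \<oplus>\<^bsub>L\<^esub> h \<in> carrier L"
proof -
  have "supp (g \<oplus>\<^bsub>L\<^esub> h) \<subseteq> supp g \<union> supp h"
    by (auto simp: laurent_support_def laurent_add)
  moreover have "finite (supp g \<union> supp h)" using assms by (simp add: laurent_carrier)
  ultimately have "finite (supp (g \<oplus>\<^bsub>L\<^esub> h))" by (rule finite_subset)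
  then show ?thesis using assms by (simp add: laurent_carrier laurent_add)
qed

lemma term_at_closed: "c \<in> carrier R \<Longrightarrow> term_at R c n \<in> carrier L"
  by (auto simp: laurent_carrier term_at_def laurent_support_def)

lemma term_at_mult:
  assumes c: "c \<in> carrier R" and g: "g \<in> carrier L"
  shows "(term_at R c n \<otimes>\<^bsub>L\<^esub> g) k = c \<otimes> g (k - n)"
  using laurent_coeff[OF g] c
  by (subst laurent_mult[OF term_at_closed[OF c] g, of "{n}"]) (auto simp: laurent_support_def term_at_def)

lemma laurent_mult_assoc:
  assumes g: "g \<in> carrier L" and h: "h \<in> carrier L" and l: "l \<in> carrier L"
  shows "(g \<otimes>\<^bsub>L\<^esub> h) \<otimes>\<^bsub>L\<^esub> l = g \<otimes>\<^bsub>L\<^esub> (h \<otimes>\<^bsub>L\<^esub> l)"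
proof
  fix k
  note cf = laurent_coeff[OF g] laurent_coeff[OF h] laurent_coeff[OF l]
  define J where "J = (\<lambda>(i, m). i + m) ` (supp g \<times> supp h)"
  have fin: "finite (supp g)" "finite (supp h)" using g h by (auto simp: laurent_carrier)
  then have J: "finite J" by (simp add: J_def)
  have "((g \<otimes>\<^bsub>L\<^esub> h) \<otimes>\<^bsub>L\<^esub> l) k = (\<Oplus>j \<in> J. (g \<otimes>\<^bsub>L\<^esub> h) j \<otimes> l (k - j))"
    using support_mult[OF g h] unfolding J_def[symmetric]
    by (rule laurent_mult[OF laurent_mult_closed[OF g h] l J])
  also have "\<dots> = (\<Oplus>j \<in> J. \<Oplus>i \<in> supp g. (g i \<otimes> h (j - i)) \<otimes> l (k - j))"
    unfolding laurent_mult[OF g h fin(1) subset_refl]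
    using cf fin J by (intro finsum_cong' finsum_ldistr) auto
  also have "\<dots> = (\<Oplus>i \<in> supp g. \<Oplus>j \<in> J. (g i \<otimes> h (j - i)) \<otimes> l (k - j))"
    using cf fin J by (intro finsum_finsum_swap) auto
  also have "\<dots> = (\<Oplus>i \<in> supp g. g i \<otimes> (h \<otimes>\<^bsub>L\<^esub> l) (k - i))"
  proof (rule finsum_cong')
    fix i assume i: "i \<in> supp g"
    let ?I = "(\<lambda>j. j - i) ` J"
    have "supp h \<subseteq> ?I"
    proof
      fix m assume "m \<in> supp h"
      then have "i + m \<in> J" using i by (force simp: J_def)
      then show "m \<in> ?I" by (force intro: image_eqI[of _ _ "i + m"])
    qed
    then have "(h \<otimes>\<^bsub>L\<^esub> l) (k - i) = (\<Oplus>m \<in> ?I. h m \<otimes> l (k - i - m))"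
      using J by (intro laurent_mult[OF h l]) auto
    also have "\<dots> = (\<Oplus>j \<in> J. h (j - i) \<otimes> l (k - i - (j - i)))"
      using cf by (intro finsum_reindex) (auto simp: inj_on_def)
    finally have eq: "(h \<otimes>\<^bsub>L\<^esub> l) (k - i) = (\<Oplus>j \<in> J. h (j - i) \<otimes> l (k - j))" by simp
    have "g i \<otimes> (h \<otimes>\<^bsub>L\<^esub> l) (k - i) = (\<Oplus>j \<in> J. g i \<otimes> (h (j - i) \<otimes> l (k - j)))"
      unfolding eq using cf J by (intro finsum_rdistr) auto
    also have "\<dots> = (\<Oplus>j \<in> J. (g i \<otimes> h (j - i)) \<otimes> l (k - j))"
      using cf by (intro finsum_cong') (auto simp: m_assoc)
    finally show "(\<Oplus>j \<in> J. (g i \<otimes> h (j - i)) \<otimes> l (k - j)) = g i \<otimes> (h \<otimes>\<^bsub>L\<^esub> l) (k - i)" ..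
  qed (use cf laurent_coeff[OF laurent_mult_closed[OF h l]] in auto)
  also have "\<dots> = (g \<otimes>\<^bsub>L\<^esub> (h \<otimes>\<^bsub>L\<^esub> l)) k"
    by (rule laurent_mult[OF g laurent_mult_closed[OF h l] fin(1) subset_refl, symmetric])
  finally show "((g \<otimes>\<^bsub>L\<^esub> h) \<otimes>\<^bsub>L\<^esub> l) k = (g \<otimes>\<^bsub>L\<^esub> (h \<otimes>\<^bsub>L\<^esub> l)) k" .
qed

lemma laurent_mult_comm:
  assumes g: "g \<in> carrier L" and h: "h \<in> carrier L"
  shows "g \<otimes>\<^bsub>L\<^esub> h = h \<otimes>\<^bsub>L\<^esub> g"
proof
  fix k
  note cf = laurent_coeff[OF g] laurent_coeff[OF h]
  define I where "I = supp g \<union> (\<lambda>m. k - m) ` supp h"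
  have fin: "finite I" using g h by (simp add: I_def laurent_carrier)
  have "supp h \<subseteq> (\<lambda>i. k - i) ` I" by (auto simp: I_def image_Un image_image)
  then have "(h \<otimes>\<^bsub>L\<^esub> g) k = (\<Oplus>m \<in> (\<lambda>i. k - i) ` I. h m \<otimes> g (k - m))"
    using fin by (intro laurent_mult[OF h g]) auto
  also have "\<dots> = (\<Oplus>i \<in> I. h (k - i) \<otimes> g (k - (k - i)))"
    using cf by (intro finsum_reindex) (auto simp: inj_on_def)
  also have "\<dots> = (\<Oplus>i \<in> I. g i \<otimes> h (k - i))"
    using cf by (intro finsum_cong') (auto simp: m_comm)
  also have "\<dots> = (g \<otimes>\<^bsub>L\<^esub> h) k"
    using fin by (intro laurent_mult[OF g h, symmetric]) (auto simp: I_def)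
  finally show "(g \<otimes>\<^bsub>L\<^esub> h) k = (h \<otimes>\<^bsub>L\<^esub> g) k" ..
qed

lemma laurent_distrib:
  assumes g: "g \<in> carrier L" and h: "h \<in> carrier L" and l: "l \<in> carrier L"
  shows "(g \<oplus>\<^bsub>L\<^esub> h) \<otimes>\<^bsub>L\<^esub> l = (g \<otimes>\<^bsub>L\<^esub> l) \<oplus>\<^bsub>L\<^esub> (h \<otimes>\<^bsub>L\<^esub> l)"
proof
  fix k
  note cf = laurent_coeff[OF g] laurent_coeff[OF h] laurent_coeff[OF l]
  define I where "I = supp g \<union> supp h"
  have I: "finite I" "supp g \<subseteq> I" "supp h \<subseteq> I" "supp (g \<oplus>\<^bsub>L\<^esub> h) \<subseteq> I"
    using g h by (auto simp: I_def laurent_carrier laurent_support_def laurent_add)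
  have "((g \<oplus>\<^bsub>L\<^esub> h) \<otimes>\<^bsub>L\<^esub> l) k = (\<Oplus>i \<in> I. (g i \<otimes> l (k - i)) \<oplus> (h i \<otimes> l (k - i)))"
    unfolding laurent_mult[OF laurent_add_closed[OF g h] l I(1,4)] laurent_add
    using cf by (intro finsum_cong') (auto simp: l_distr)
  also have "\<dots> = (\<Oplus>i \<in> I. g i \<otimes> l (k - i)) \<oplus> (\<Oplus>i \<in> I. h i \<otimes> l (k - i))"
    using cf by (intro finsum_addf) auto
  finally show "((g \<oplus>\<^bsub>L\<^esub> h) \<otimes>\<^bsub>L\<^esub> l) k = ((g \<otimes>\<^bsub>L\<^esub> l) \<oplus>\<^bsub>L\<^esub> (h \<otimes>\<^bsub>L\<^esub> l)) k"
    unfolding laurent_add laurent_mult[OF g l I(1,2)] laurent_mult[OF h l I(1,3)] .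
qed

lemma laurent_cring: "cring L"
proof (rule cringI)
  show "abelian_group L"
  proof (rule abelian_groupI)
    fix g assume g: "g \<in> carrier L"
    have "(\<lambda>i. \<ominus> g i) \<in> carrier L"
      using g by (auto simp: laurent_carrier laurent_support_def elim!: rev_finite_subset)
    moreover have "(\<lambda>i. \<ominus> g i) \<oplus>\<^bsub>L\<^esub> g = \<zero>\<^bsub>L\<^esub>"
      using laurent_coeff[OF g] by (auto simp: laurent_add laurent_zero l_neg)
    ultimately show "\<exists>h \<in> carrier L. h \<oplus>\<^bsub>L\<^esub> g = \<zero>\<^bsub>L\<^esub>" by blast
  next
    show "\<zero>\<^bsub>L\<^esub> \<in> carrier L" by (simp add: laurent_carrier laurent_zero laurent_support_def)
  qed (auto simp: laurent_add_closed fun_eq_iff laurent_add laurent_zero laurent_coeff a_assoc intro: a_comm)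
  show "comm_monoid L"
  proof (rule comm_monoidI)
    fix g assume g: "g \<in> carrier L"
    show "\<one>\<^bsub>L\<^esub> \<otimes>\<^bsub>L\<^esub> g = g"
      using g by (auto simp: laurent_one term_at_mult laurent_coeff)
  qed (use laurent_mult_closed laurent_mult_assoc laurent_mult_comm term_at_closed[of \<one> 0] in
    \<open>auto simp: laurent_one\<close>)
qed (rule laurent_distrib)

text \<open>As for polynomials, the leading coefficients multiply, so there are no zero divisors.\<close>

lemma laurent_top_coeff:
  assumes g: "g \<in> carrier L" and h: "h \<in> carrier L"
    and a: "\<And>i. i \<in> supp g \<Longrightarrow> i \<le> a" and b: "\<And>i. i \<in> supp h \<Longrightarrow> i \<le> b"
  shows "(g \<otimes>\<^bsub>L\<^esub> h) (a + b) = g a \<otimes> h b"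
proof -
  note cf = laurent_coeff[OF g] laurent_coeff[OF h]
  let ?I = "insert a (supp g)"
  have fin: "finite ?I" using g by (simp add: laurent_carrier)
  have "(g \<otimes>\<^bsub>L\<^esub> h) (a + b) = (\<Oplus>i \<in> ?I. g i \<otimes> h (a + b - i))"
    by (rule laurent_mult[OF g h fin]) auto
  also have "\<dots> = (\<Oplus>i \<in> ?I. if a = i then g i \<otimes> h b else \<zero>)"
  proof (rule finsum_cong')
    fix i assume i: "i \<in> ?I"
    show "g i \<otimes> h (a + b - i) = (if a = i then g i \<otimes> h b else \<zero>)"
    proof (cases "a = i")
      case False
      then have "i < a" using i a by force
      then have "a + b - i \<notin> supp h" using b by force
      then show ?thesis using False cf by (simp add: laurent_support_def)
    qed simp
  qed (use cf in auto)
  also have "\<dots> = g a \<otimes> h b"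
    using cf fin by (intro finsum_singleton) auto
  finally show ?thesis .
qed

lemma support_nonempty: "g \<in> carrier L \<Longrightarrow> g \<noteq> \<zero>\<^bsub>L\<^esub> \<Longrightarrow> supp g \<noteq> {}"
  by (auto simp: laurent_support_def laurent_zero)

lemma laurent_domain: "domain L"
proof (intro domain.intro domain_axioms.intro laurent_cring)
  show "\<one>\<^bsub>L\<^esub> \<noteq> \<zero>\<^bsub>L\<^esub>" by (auto simp: laurent_one laurent_zero term_at_def fun_eq_iff)
  fix g h assume 0: "g \<otimes>\<^bsub>L\<^esub> h = \<zero>\<^bsub>L\<^esub>" and g: "g \<in> carrier L" and h: "h \<in> carrier L"
  show "g = \<zero>\<^bsub>L\<^esub> \<or> h = \<zero>\<^bsub>L\<^esub>"
  proof (rule ccontr)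
    assume n: "\<not> (g = \<zero>\<^bsub>L\<^esub> \<or> h = \<zero>\<^bsub>L\<^esub>)"
    let ?a = "Max (supp g)" and ?b = "Max (supp h)"
    have fin: "finite (supp g)" "finite (supp h)" using g h by (auto simp: laurent_carrier)
    moreover have ne: "supp g \<noteq> {}" "supp h \<noteq> {}" using n g h support_nonempty by auto
    ultimately have "g ?a \<noteq> \<zero>" "h ?b \<noteq> \<zero>"
      using Max_in[of "supp g"] Max_in[of "supp h"] unfolding laurent_support_def by auto
    moreover have "g ?a \<otimes> h ?b = \<zero>"
      using laurent_top_coeff[OF g h Max_ge[OF fin(1)] Max_ge[OF fin(2)]] 0 by (simp add: laurent_zero)
    ultimately show False using integral[of "g ?a" "h ?b"] laurent_coeff g h by auto
  qed
qed

text \<open>Division by \<open>f\<close> from both ends: a multiple of \<open>f\<close> by a term cancels the lowest coefficient of \<open>g\<close>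
  if it lies below \<open>lo\<close>, and the highest one if it lies at or above \<open>hi\<close>. Thus the remainder lies in
  a window that does not depend on \<open>g\<close>; this gives a Euclidean division and, over a finite field,
  leaves only finitely many remainders.\<close>

lemma laurent_divide_aux:
  assumes f: "f \<in> carrier L" "f lo \<noteq> \<zero>" "f hi \<noteq> \<zero>" "supp f \<subseteq> {lo..hi}"
    and g: "g \<in> carrier L" "supp g \<subseteq> {a..<b}" "a \<le> lo" "hi \<le> b"
  shows "\<exists>q \<in> carrier L. \<exists>r \<in> carrier L. g = f \<otimes>\<^bsub>L\<^esub> q \<oplus>\<^bsub>L\<^esub> r \<and> supp r \<subseteq> {lo..<hi}"
proof -
  interpret laurent: cring L by (rule laurent_cring)
  show ?thesis using g
  proof (induction "nat (lo - a) + nat (b - hi)" arbitrary: g a b rule: less_induct)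
    case (less a b g)
    have lohi: "lo \<le> hi" using f(2,4) by (auto simp: laurent_support_def)
    (* cancels the coefficient at e by the coefficient of f at n, where n is an end of f *)
    have cancel: ?case
      if n: "n = lo \<and> e = a \<or> n = hi \<and> e = b - 1"
        and sub: "{a'..<b'} \<subseteq> {a..<b}" "{a..<b} \<subseteq> insert e {a'..<b'}" "e \<notin> {a'..<b'}"
        and mv: "\<And>i. i \<in> {lo..hi} \<Longrightarrow> i + (e - n) \<in> {a..<b}"
        and ab: "a' \<le> lo" "hi \<le> b'" "nat (lo - a') + nat (b' - hi) < nat (lo - a) + nat (b - hi)"
      for n e a' b'
    proof -
      have fn: "f n \<noteq> \<zero>" "f n \<in> carrier R" using n f by (auto simp: laurent_coeff)
      define c where "c = g e \<otimes> inv (f n)"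
      have c: "c \<in> carrier R" using fn less.prems(1) by (simp add: c_def laurent_coeff field_Units)
      have ce: "c \<otimes> f n = g e"
        using fn less.prems(1) by (simp add: c_def m_assoc laurent_coeff field_Units)
      define t where "t = term_at R c (e - n)"
      have t: "t \<in> carrier L" unfolding t_def by (rule term_at_closed[OF c])
      define g' where "g' = g \<ominus>\<^bsub>L\<^esub> (t \<otimes>\<^bsub>L\<^esub> f)"
      have g': "g' \<in> carrier L" using less.prems(1) t f(1) by (simp add: g'_def)
      have gg: "g = g' \<oplus>\<^bsub>L\<^esub> (t \<otimes>\<^bsub>L\<^esub> f)"
        using less.prems(1) t f(1) unfolding g'_def by algebra
      have tf: "(t \<otimes>\<^bsub>L\<^esub> f) i = c \<otimes> f (i - (e - n))" for i
        unfolding t_def by (rule term_at_mult[OF c f(1)])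
      have gi: "g i = g' i \<oplus> c \<otimes> f (i - (e - n))" for i
        using gg laurent_add[of g' "t \<otimes>\<^bsub>L\<^esub> f" i] by (simp add: tf)
      have zero: "g' i = \<zero>" if "i \<notin> {a'..<b'}" for i
      proof -
        have cl: "g' i \<in> carrier R" "f (i - (e - n)) \<in> carrier R"
          using g' f(1) by (auto simp: laurent_coeff)
        have "g i = c \<otimes> f (i - (e - n))"
        proof (cases "i = e")
          case False
          then have "i \<notin> {a..<b}" using that sub by blast
          then have "g i = \<zero>" "i - (e - n) \<notin> {lo..hi}"
            using less.prems(2) mv[of "i - (e - n)"] by (auto simp: laurent_support_def)
          moreover from this have "f (i - (e - n)) = \<zero>" using f(4) by (auto simp: laurent_support_def)
          ultimately show ?thesis using c by simp
        qed (use ce in simp)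
        then show ?thesis using gi[of i] cl c
          by (metis add.l_cancel_one' add.m_comm m_closed)
      qed
      have "supp g' \<subseteq> {a'..<b'}" using zero unfolding laurent_support_def by blast
      then obtain q r where qr: "q \<in> carrier L" "r \<in> carrier L" "g' = f \<otimes>\<^bsub>L\<^esub> q \<oplus>\<^bsub>L\<^esub> r" "supp r \<subseteq> {lo..<hi}"
        using less.hyps[OF ab(3) g' _ ab(1,2)] by blast
      have "g = f \<otimes>\<^bsub>L\<^esub> (q \<oplus>\<^bsub>L\<^esub> t) \<oplus>\<^bsub>L\<^esub> r"
        unfolding gg qr(3) using qr(1,2) f(1) t by algebra
      then show ?thesis using qr t by blast
    qed
    consider "a < lo" | "a = lo" "hi < b" | "a = lo" "b = hi" using less.prems by linarith
    then show ?case
    proof cases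
      case 1
      then show ?thesis using less.prems lohi by (intro cancel[of lo a "a + 1" b]) auto
    next
      case 2
      then show ?thesis using less.prems lohi by (intro cancel[of hi "b - 1" a "b - 1"]) auto
    next
      case 3
      have "g = f \<otimes>\<^bsub>L\<^esub> \<zero>\<^bsub>L\<^esub> \<oplus>\<^bsub>L\<^esub> g" using less.prems(1) f(1) by simp
      then show ?thesis using less.prems 3 by blast
    qed
  qed
qed

lemma laurent_divide:
  assumes f: "f \<in> carrier L" "f \<noteq> \<zero>\<^bsub>L\<^esub>" and g: "g \<in> carrier L"
  shows "\<exists>q \<in> carrier L. \<exists>r \<in> carrier L. g = f \<otimes>\<^bsub>L\<^esub> q \<oplus>\<^bsub>L\<^esub> r \<and>
    supp r \<subseteq> {Min (supp f)..<Max (supp f)}"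
proof -
  let ?lo = "Min (supp f)" and ?hi = "Max (supp f)"
  have fin: "finite (supp f)" "finite (supp g)" using f g by (auto simp: laurent_carrier)
  have "supp f \<noteq> {}" using f by (rule support_nonempty)
  then have "f ?lo \<noteq> \<zero>" "f ?hi \<noteq> \<zero>"
    using Min_in[OF fin(1)] Max_in[OF fin(1)] unfolding laurent_support_def by auto
  moreover have "supp f \<subseteq> {?lo..?hi}" using fin(1) by auto
  moreover define a where "a = Min (insert ?lo (supp g))"
  moreover define b where "b = Max (insert ?hi (supp g)) + 1"
  moreover have "i \<in> {a..<b}" if "i \<in> supp g" for i
    using Min_le[of "insert ?lo (supp g)" i] Max_ge[of "insert ?hi (supp g)" i] fin that
    by (simp add: a_def b_def)
  moreover have "a \<le> ?lo" using fin by (simp add: a_def)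
  moreover have "?hi \<le> Max (insert ?hi (supp g))" by (rule Max_ge) (use fin in auto)
  then have "?hi \<le> b" unfolding b_def by linarith
  ultimately show ?thesis by (intro laurent_divide_aux[OF f(1) _ _ _ g, of ?lo ?hi a b]) auto
qed

lemma laurent_euclidean: "euclidean_domain L (\<lambda>g. nat (laurent_degree R g))"
proof -
  interpret laurent: domain L by (rule laurent_domain)
  show ?thesis
  proof (rule laurent.euclidean_domainI)
    fix g f assume gf: "g \<in> carrier L - {\<zero>\<^bsub>L\<^esub>}" "f \<in> carrier L - {\<zero>\<^bsub>L\<^esub>}"
    then obtain q r where qr: "q \<in> carrier L" "r \<in> carrier L" "g = f \<otimes>\<^bsub>L\<^esub> q \<oplus>\<^bsub>L\<^esub> r"
      and r: "supp r \<subseteq> {Min (supp f)..<Max (supp f)}"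
      using laurent_divide[of f g] by blast
    have "nat (laurent_degree R r) < nat (laurent_degree R f)" if "r \<noteq> \<zero>\<^bsub>L\<^esub>"
    proof -
      have fin: "finite (supp r)" "supp r \<noteq> {}"
        using qr(2) that support_nonempty by (auto simp: laurent_carrier)
      have "Min (supp r) \<in> {Min (supp f)..<Max (supp f)}"
        "Max (supp r) \<in> {Min (supp f)..<Max (supp f)}"
        using Min_in[OF fin] Max_in[OF fin] r by blast+
      then show ?thesis unfolding laurent_degree_def laurent_support_def[symmetric] by auto
    qed
    then show "\<exists>q r. q \<in> carrier L \<and> r \<in> carrier L \<and> g = f \<otimes>\<^bsub>L\<^esub> q \<oplus>\<^bsub>L\<^esub> r \<and>
        (r = \<zero>\<^bsub>L\<^esub> \<or> nat (laurent_degree R r) < nat (laurent_degree R f))"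
      using qr by blast
  qed
qed

lemma laurent_quotient_field:
  assumes "f \<in> carrier L" "ring_irreducible\<^bsub>L\<^esub> f"
  shows "field (L Quot (PIdl\<^bsub>L\<^esub> f))"
proof -
  interpret laurent: euclidean_domain L "\<lambda>g. nat (laurent_degree R g)" by (rule laurent_euclidean)
  show ?thesis
    by (rule maximalideal.quotient_is_field[OF laurent.irreducible_imp_maximalideal[OF assms] laurent_cring])
qed

lemma laurent_quotient_finite:
  assumes fin: "finite (carrier R)" and f: "f \<in> carrier L" "f \<noteq> \<zero>\<^bsub>L\<^esub>"
  shows "finite (carrier (L Quot (PIdl\<^bsub>L\<^esub> f)))"
proof -
  interpret laurent: cring L by (rule laurent_cring)
  let ?I = "PIdl\<^bsub>L\<^esub> f"
  let ?B = "{Min (supp f)..<Max (supp f)}"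
  define S where "S = {r. \<forall>i. (i \<in> ?B \<longrightarrow> r i \<in> carrier R) \<and> (i \<notin> ?B \<longrightarrow> r i = \<zero>)}"
  have id: "ideal ?I L" by (rule laurent.cgenideal_ideal[OF f(1)])
  have "finite S" unfolding S_def by (rule finite_set_of_finite_funs) (use fin in auto)
  moreover have "carrier (L Quot ?I) \<subseteq> (\<lambda>r. ?I +>\<^bsub>L\<^esub> r) ` S"
  proof
    fix U assume "U \<in> carrier (L Quot ?I)"
    then obtain g where g: "g \<in> carrier L" "U = ?I +>\<^bsub>L\<^esub> g"
      by (auto simp: FactRing_def A_RCOSETS_def')
    obtain q r where qr: "q \<in> carrier L" "r \<in> carrier L" "g = f \<otimes>\<^bsub>L\<^esub> q \<oplus>\<^bsub>L\<^esub> r" "supp r \<subseteq> ?B"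
      using laurent_divide[OF f g(1)] by blast
    have "g \<ominus>\<^bsub>L\<^esub> r = q \<otimes>\<^bsub>L\<^esub> f" unfolding qr(3) using qr(1,2) f(1) by algebra
    then have "g \<ominus>\<^bsub>L\<^esub> r \<in> ?I" using qr(1) unfolding cgenideal_def by auto
    then have "U = ?I +>\<^bsub>L\<^esub> r"
      using laurent.quotient_eq_iff_same_a_r_cos[OF id g(1) qr(2)] g(2) by simp
    moreover have "r \<in> S" using qr(2,4) by (auto simp: S_def laurent_support_def laurent_coeff)
    ultimately show "U \<in> (\<lambda>r. ?I +>\<^bsub>L\<^esub> r) ` S" by blast
  qed
  ultimately show ?thesis by (rule finite_surj)
qed

lemma laurent_var_quotient_unit:
  assumes f: "f \<in> carrier L"
  shows "PIdl\<^bsub>L\<^esub> f +>\<^bsub>L\<^esub> laurent_var R \<in> Units (L Quot (PIdl\<^bsub>L\<^esub> f))"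
proof -
  interpret laurent: cring L by (rule laurent_cring)
  let ?I = "PIdl\<^bsub>L\<^esub> f"
  let ?Q = "L Quot ?I"
  let ?t = "term_at R \<one> 1" and ?s = "term_at R \<one> (- 1)"
  have var: "laurent_var R = ?t" by (simp add: laurent_var_def term_at_def)
  have ts: "?t \<in> carrier L" "?s \<in> carrier L" by (simp_all add: term_at_closed)
  have one: "?t \<otimes>\<^bsub>L\<^esub> ?s = \<one>\<^bsub>L\<^esub>" "?s \<otimes>\<^bsub>L\<^esub> ?t = \<one>\<^bsub>L\<^esub>"
    using ts by (auto simp: fun_eq_iff term_at_mult laurent_one) (auto simp: term_at_def)
  have hom: "(+>\<^bsub>L\<^esub>) ?I \<in> ring_hom L ?Q"
    by (rule ideal.rcos_ring_hom[OF laurent.cgenideal_ideal[OF f]])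
  note h = ring_hom_mult[OF hom ts] ring_hom_mult[OF hom ts(2,1)]
  show ?thesis
    unfolding var Units_def using h[symmetric] ring_hom_closed[OF hom] ts ring_hom_one[OF hom]
    by (auto simp: one)
qed

end

section \<open>The lower bound for the unknotting twist number\<close>

theorem theorem5p1:
  fixes p d :: nat
    and f :: "int \<Rightarrow> int"
    and K :: "passage list set"
    and D :: "passage list"
  assumes "Factorial_Ring.prime p"
    and "f \<in> carrier (\<Lambda> p)"
    and "ring_irreducible\<^bsub>\<Lambda> p\<^esub> f"
    and "laurent_degree (residue_ring (int p)) f = int d"
    and "d \<ge> 1"
    and "f \<noteq> Lambda_t p"
    and "f \<noteq> Lambda_t p \<ominus>\<^bsub>\<Lambda> p\<^esub> \<one>\<^bsub>\<Lambda> p\<^esub>"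
    and "K \<in> welded_knots"
    and "D \<in> K"
  shows "int (vectorspace.dim (Fq p f) (Col (Fq p f) (Fq_t p f) D)) - 1 \<le> int (ut_knot K)"
proof -
  interpret R: residues_prime p "residue_ring (int p)"
    by (rule residues_prime.intro) (rule assms(1))
  have "f \<noteq> \<zero>\<^bsub>\<Lambda> p\<^esub>" using assms(3) by (simp add: ring_irreducible_def)
  moreover have "finite (carrier (residue_ring (int p)))" by (simp add: residue_ring_def)
  ultimately have finite: "finite (carrier (Fq p f))"
    unfolding Fq_def using R.laurent_quotient_finite assms(2) by blast
  have field: "field (Fq p f)"
    unfolding Fq_def by (rule R.laurent_quotient_field[OF assms(2,3)])
  have unit: "Fq_t p f \<in> Units (Fq p f)"
    unfolding Fq_def Fq_t_def by (rule R.laurent_var_quotient_unit[OF assms(2)])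
  have "vectorspace.dim (Fq p f) (Col (Fq p f) (Fq_t p f) D) \<le> ut_knot K + 1"
    by (rule dim_Col_le_ut_knot_finite_field[OF field finite unit assms(8,9)])
  then show ?thesis by linarith
qed

end
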